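(* Let $F$ and $G$ be fixed nonempty graphs without isolated vertices with $\chi(F)<\chi(G)$. Then, as $n\to\infty$, $$\mathrm{ex}_F(n,G)\sim \frac{\mathrm{ex}(n,G)}{e(F)}\sim \frac{1-\frac{1}{\chi(G)-1}}{2e(F)}\,n^2.$$
   Context: All graphs are simple; $e(F)$ is the number of edges and $\chi$ the chromatic number. $\mathrm{ex}(n,G)$ is the ordinary Turán number: the maximum number of edges of an $n$-vertex graph with no subgraph isomorphic to $G$. $\mathrm{ex}_F(n,G)$ is the maximum $k$ such that there exist $k$ pairwise edge-disjoint subgraphs $F_1,\dots,F_k$ of $K_n$, each isomorphic to $F$, such that $\bigcup_i F_i$ contains no subgraph $G'$ isomorphic to $G$ with $|E(G')\cap E(F_i)|\le 1$ for every $i$. *)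

theory Defs
  imports "HOL-Library.Landau_Symbols"
begin

datatype 'a graph = Graph (verts: "'a set") (edges: "'a set set")

definition simple_graph :: "'a graph \<Rightarrow> bool" where
  "simple_graph H \<longleftrightarrow> finite (verts H) \<and> (\<forall>e\<in>edges H. e \<subseteq> verts H \<and> card e = 2)"

definition num_edges :: "'a graph \<Rightarrow> nat" where
  "num_edges H = card (edges H)"

definition no_isolated_vertices :: "'a graph \<Rightarrow> bool" where
  "no_isolated_vertices H \<longleftrightarrow> (\<forall>v\<in>verts H. \<exists>e\<in>edges H. v \<in> e)"

definition proper_coloring :: "'a graph \<Rightarrow> nat \<Rightarrow> ('a \<Rightarrow> nat) \<Rightarrow> bool" where
  "proper_coloring H k c \<longleftrightarrow>
     (\<forall>v\<in>verts H. c v < k) \<and> (\<forall>u v. {u, v} \<in> edges H \<longrightarrow> c u \<noteq> c v)"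

definition chromatic_number :: "'a graph \<Rightarrow> nat" where
  "chromatic_number H = (LEAST k. \<exists>c. proper_coloring H k c)"

definition complete_graph :: "nat \<Rightarrow> nat graph" where
  "complete_graph n = Graph {..<n} {e. e \<subseteq> {..<n} \<and> card e = 2}"

definition subgraph :: "'a graph \<Rightarrow> 'a graph \<Rightarrow> bool" where
  "subgraph H K \<longleftrightarrow> simple_graph H \<and> verts H \<subseteq> verts K \<and> edges H \<subseteq> edges K"

definition isomorphic :: "'a graph \<Rightarrow> 'b graph \<Rightarrow> bool" where
  "isomorphic H K \<longleftrightarrow>
     (\<exists>f. bij_betw f (verts H) (verts K) \<and>
          (\<forall>u\<in>verts H. \<forall>v\<in>verts H. {u, v} \<in> edges H \<longleftrightarrow> {f u, f v} \<in> edges K))"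

definition graph_union :: "nat \<Rightarrow> (nat \<Rightarrow> 'a graph) \<Rightarrow> 'a graph" where
  "graph_union k Fs = Graph (\<Union>i<k. verts (Fs i)) (\<Union>i<k. edges (Fs i))"

text \<open>The set below is finite, its elements being at most \<open>n choose 2\<close>; it is nonempty as soon
  as \<open>G\<close> has an edge. Vertices are natural numbers, which loses no finite graph up to isomorphism.\<close>

definition turan_number :: "nat \<Rightarrow> 'b graph \<Rightarrow> nat" where
  "turan_number n G =
     Max {num_edges H | H :: nat graph.
            simple_graph H \<and> card (verts H) = n \<and>
            \<not> (\<exists>G'. subgraph G' H \<and> isomorphic G' G)}"

definition F_packing :: "'a graph \<Rightarrow> nat \<Rightarrow> nat \<Rightarrow> (nat \<Rightarrow> nat graph) \<Rightarrow> bool" where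
  "F_packing F n k Fs \<longleftrightarrow>
     (\<forall>i<k. subgraph (Fs i) (complete_graph n) \<and> isomorphic (Fs i) F) \<and>
     (\<forall>i<k. \<forall>j<k. i \<noteq> j \<longrightarrow> edges (Fs i) \<inter> edges (Fs j) = {})"

definition rainbow_copy :: "'b graph \<Rightarrow> nat \<Rightarrow> (nat \<Rightarrow> nat graph) \<Rightarrow> nat graph \<Rightarrow> bool" where
  "rainbow_copy G k Fs G' \<longleftrightarrow>
     subgraph G' (graph_union k Fs) \<and> isomorphic G' G \<and>
     (\<forall>i<k. card (edges G' \<inter> edges (Fs i)) \<le> 1)"

text \<open>If \<open>F\<close> and \<open>G\<close> have an edge, the set below is finite, its elements being at most
  \<open>n choose 2\<close>, and contains \<open>0\<close>.\<close>

definition F_turan_number :: "'a graph \<Rightarrow> nat \<Rightarrow> 'b graph \<Rightarrow> nat" where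
  "F_turan_number F n G =
     Max {k. \<exists>Fs. F_packing F n k Fs \<and> \<not> (\<exists>G'. rainbow_copy G k Fs G')}"

end

theory Submission
  imports Defs "HOL-Number_Theory.Number_Theory" "HOL-Combinatorics.Permutations"
begin

text \<open>Put \<open>s = \<chi>(G) - 1\<close>. For the upper bounds, the Erdos-Stone theorem yields a complete
  \<open>(s+1)\<close>-partite graph with large parts in any graph with noticeably more than
  \<open>(1 - 1/s) n\<^sup>2 / 2\<close> edges; if that graph is the union of an \<open>F\<close>-packing, almost every transversal
  embedding of \<open>G\<close> is rainbow, because each edge forbids only \<open>|V(F)|\<close> places for every other vertex.

  For the lower bounds, \<open>F\<close> is \<open>s\<close>-colourable and the complete \<open>s\<close>-partite graph contains no \<open>G\<close>, so
  it suffices to pack it almost perfectly with copies of \<open>F\<close>. Take \<open>\<int>\<^sub>p\<^sup>I\<close> for every part and place the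
  copies \<open>v \<mapsto> (\<sigma>(c(v)), x + a\<^sub>v y)\<close>, where \<open>c\<close> colours \<open>F\<close>, \<open>\<sigma>\<close> permutes the parts, and \<open>y\<close> has nonzero
  coordinates and lies in the kernel of a character \<open>\<kappa>(z) = \<Prod> z\<^sub>i\<^sup>\<plusminus>\<^sup>1\<close>. Differences along the
  edge \<open>uv\<close> fill one class of \<open>\<kappa>\<close>, that of \<open>a\<^sub>u - a\<^sub>v\<close>; the labels \<open>a\<close> can realise any prescribed
  classes, so different edges get different classes and the copies are edge-disjoint. One
  such packing of a fixed size is carried over to all \<open>n\<close> by blowing up each point with the family
  \<open>i \<mapsto> x + i y\<close> of lines modulo an integer \<open>m\<close> coprime to \<open>s!\<close>.\<close>

section \<open>The Erdos-Stone theorem\<close>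

text \<open>\<open>E\<close> is kept separate from \<open>V\<close>, so that one edge set serves all
  vertex subsets. Disjointness of the parts is implicit for graphs: a common point \<open>a\<close>
  of two parts would put the singleton \<open>{a}\<close> into \<open>E\<close>.\<close>

definition has_partite :: "'a set \<Rightarrow> 'a set set \<Rightarrow> nat \<Rightarrow> nat \<Rightarrow> bool" where
  "has_partite V E r t \<longleftrightarrow>
     (\<exists>A. (\<forall>i<r. A i \<subseteq> V \<and> card (A i) = t) \<and>
          (\<forall>i<r. \<forall>j<r. i \<noteq> j \<longrightarrow> (\<forall>a\<in>A i. \<forall>b\<in>A j. {a, b} \<in> E)))"

lemma has_partite_mono:
  assumes "has_partite U E r t" and "U \<subseteq> V"
  shows "has_partite V E r t"
proof -
  obtain A where "\<forall>i<r. A i \<subseteq> U \<and> card (A i) = t"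
    and "\<forall>i<r. \<forall>j<r. i \<noteq> j \<longrightarrow> (\<forall>a\<in>A i. \<forall>b\<in>A j. {a, b} \<in> E)"
    using assms(1) unfolding has_partite_def by (elim exE conjE)
  with assms(2) show ?thesis unfolding has_partite_def by (intro exI[of _ A]) blast
qed

lemma card_filter_split:
  assumes "finite V"
  shows "card V = card {u \<in> V. Q u} + card {u \<in> V. \<not> Q u}"
proof -
  have "V = {u \<in> V. Q u} \<union> {u \<in> V. \<not> Q u}" by blast
  then show ?thesis
    using card_Un_disjoint[of "{u \<in> V. Q u}" "{u \<in> V. \<not> Q u}"] assms by fastforce
qed

lemma large_fibre:
  assumes "finite W" and "finite P" and "f ` W \<subseteq> P" and "card P * t < card W"
  shows "\<exists>y\<in>P. t < card {w \<in> W. f w = y}"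
proof (rule ccontr)
  assume "\<not> ?thesis"
  then have *: "card {w \<in> W. f w = y} \<le> t" if "y \<in> P" for y
    using that by (meson not_le_imp_less)
  have "card W = (\<Sum>y\<in>P. card {w \<in> W. f w = y})"
    using sum.group[OF assms(1-3), of "\<lambda>_. 1::nat"] by simp
  also have "\<dots> \<le> card P * t"
    using sum_bounded_above[of P "\<lambda>y. card {w \<in> W. f w = y}" t] * by simp
  finally show False using assms(4) by simp
qed

text \<open>Count the non-adjacent pairs between \<open>V\<close> and the union \<open>U\<close> of
  the old parts. A vertex of \<open>U\<close> misses at most
  \<open>(1 / s - \<epsilon>) * card V\<close> vertices, whereas a vertex outside \<open>W\<close>
  misses at least \<open>T - t\<close> vertices of \<open>U\<close>; hence \<open>W\<close> takes up
  at least the share \<open>s * \<epsilon> / 2\<close> of \<open>V\<close>. By pigeonhole more than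
  \<open>t\<close> vertices of \<open>W\<close> have the same neighbourhood in \<open>U\<close>, and
  \<open>t\<close> of them form the new part.\<close>

lemma erdos_stone_step:
  fixes V :: "'a set" and \<epsilon> :: real
  assumes V: "finite V" and s: "s \<ge> 1"
    and deg: "\<And>v. v \<in> V \<Longrightarrow> (1 - 1 / real s + \<epsilon>) * card V \<le> card {u \<in> V. {u, v} \<in> E}"
    and part: "has_partite V E s T"
    and T: "T \<ge> 1" "real t \<le> s * \<epsilon> / 2 * T" "t \<le> T"
    and large: "real (2 ^ (s * T) * t) < s * \<epsilon> / 2 * card V"
  shows "has_partite V E (Suc s) t"
proof -
  obtain A where A: "\<And>i. i < s \<Longrightarrow> A i \<subseteq> V" "\<And>i. i < s \<Longrightarrow> card (A i) = T"
    and AE: "\<And>i j a b. i < s \<Longrightarrow> j < s \<Longrightarrow> i \<noteq> j \<Longrightarrow> a \<in> A i \<Longrightarrow> b \<in> A j \<Longrightarrow> {a, b} \<in> E"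
    using part unfolding has_partite_def by metis
  have finA: "finite (A i)" if "i < s" for i
    using A(2)[OF that] T(1) card.infinite by fastforce
  define U where "U = (\<Union>i<s. A i)"
  have finU: "finite U" using finA unfolding U_def by auto
  have UV: "U \<subseteq> V" using A(1) unfolding U_def by auto
  have cU: "card U \<le> s * T"
    unfolding U_def using card_UN_le[of "{..<s}" A] A(2) by simp
  define N where "N w = {a \<in> U. {w, a} \<in> E}" for w
  define W where "W = {w \<in> V. \<forall>i<s. t \<le> card (A i \<inter> N w)}"
  have finW: "finite W" using V unfolding W_def by auto
  have miss: "T - t \<le> card (U - N w)" if "w \<in> V - W" for w
  proof -
    from that obtain i where i: "i < s" "card (A i \<inter> N w) < t"
      unfolding W_def by (auto simp: not_le)
    have "card (A i) = card (A i \<inter> N w) + card (A i - N w)"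
      using card_Int_Diff finA i(1) by blast
    with i A(2) have "T - t \<le> card (A i - N w)" by fastforce
    also have "\<dots> \<le> card (U - N w)"
      using i(1) finU unfolding U_def by (intro card_mono) auto
    finally show ?thesis .
  qed
  have "real (card (V - W)) * (T - t) = (\<Sum>w\<in>V - W. real (T - t))" using T(3) by simp
  also have "\<dots> \<le> (\<Sum>w\<in>V - W. real (card (U - N w)))"
    using miss by (intro sum_mono) simp
  also have "\<dots> \<le> (\<Sum>w\<in>V. real (card (U - N w)))"
    using V by (intro sum_mono2) auto
  also have "\<dots> = (\<Sum>w\<in>V. \<Sum>a | a \<in> U \<and> {w, a} \<notin> E. 1)"
    unfolding N_def by (auto intro!: sum.cong arg_cong[where f = card])
  also have "\<dots> = (\<Sum>a\<in>U. \<Sum>w | w \<in> V \<and> {w, a} \<notin> E. 1)"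
    by (rule sum.swap_restrict[OF V finU])
  also have "\<dots> \<le> (\<Sum>a\<in>U. (1 / s - \<epsilon>) * card V)"
  proof (rule sum_mono)
    fix a assume "a \<in> U"
    then have "(1 - 1 / real s + \<epsilon>) * card V \<le> card {u \<in> V. {u, a} \<in> E}" using deg UV by blast
    moreover have "card V = card {u \<in> V. {u, a} \<in> E} + card {u \<in> V. {u, a} \<notin> E}"
      using V by (rule card_filter_split)
    ultimately have "real (card {u \<in> V. {u, a} \<notin> E}) \<le> card V - (1 - 1 / real s + \<epsilon>) * card V"
      by linarith
    also have "\<dots> = (1 / s - \<epsilon>) * card V" by (simp add: algebra_simps)
    finally show "(\<Sum>w | w \<in> V \<and> {w, a} \<notin> E. 1) \<le> (1 / s - \<epsilon>) * card V"
      by (simp only: real_of_card)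
  qed
  also have "\<dots> = card U * ((1 / s - \<epsilon>) * card V)" by simp
  also have "\<dots> \<le> real (s * T) * ((1 / s - \<epsilon>) * card V)"
  proof (rule mult_right_mono)
    have "U \<noteq> {}" using s A(2)[of 0] T(1) unfolding U_def by fastforce
    then obtain a where "a \<in> U" by auto
    then have "(1 - 1 / real s + \<epsilon>) * card V \<le> card {u \<in> V. {u, a} \<in> E}" using deg UV by blast
    also have "\<dots> \<le> card V" using V by (simp add: card_mono)
    finally show "0 \<le> (1 / s - \<epsilon>) * card V" by (simp add: algebra_simps)
    show "real (card U) \<le> real (s * T)" using cU by (rule of_nat_mono)
  qed
  also have "\<dots> = T * ((1 - s * \<epsilon>) * card V)" using s by (simp add: field_simps)
  finally have 1: "real (card (V - W)) * (T - t) \<le> T * ((1 - s * \<epsilon>) * card V)" .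
  \<comment> \<open>As \<open>t\<close> is at most the share \<open>s * \<epsilon> / 2\<close> of
    \<open>T\<close>, the factor \<open>T - t\<close> may be lowered to
    \<open>T * (1 - s * \<epsilon> / 2)\<close>, after which \<open>T\<close> cancels.\<close>
  have "T * ((1 - s * \<epsilon> / 2) * card (V - W)) \<le> real (card (V - W)) * (T - t)"
  proof -
    have "T * (1 - s * \<epsilon> / 2) \<le> real T - t" using T(2) by (simp add: algebra_simps)
    from mult_left_mono[OF this, of "card (V - W)"] show ?thesis
      using T(3) by (simp add: algebra_simps of_nat_diff)
  qed
  with 1 have "T * ((1 - s * \<epsilon> / 2) * card (V - W)) \<le> T * ((1 - s * \<epsilon>) * card V)" by linarith
  then have 2: "(1 - s * \<epsilon> / 2) * card (V - W) \<le> (1 - s * \<epsilon>) * card V" using T(1) by simp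
  \<comment> \<open>The sign of \<open>\<epsilon>\<close> is read off from \<open>large\<close>,
    whose left side is nonnegative.\<close>
  have eps: "s * \<epsilon> / 2 \<ge> 0"
  proof (rule ccontr)
    assume "\<not> s * \<epsilon> / 2 \<ge> 0"
    then have "s * \<epsilon> / 2 * card V \<le> 0" by (intro mult_nonpos_nonneg) auto
    with large show False using of_nat_0_le_iff[of "2 ^ (s * T) * t", where 'a = real] by linarith
  qed
  have "card V = card W + card (V - W)"
    using card_Diff_subset[OF finW, of V] card_mono[OF V, of W] W_def by auto
  with 2 have "s * \<epsilon> / 2 * card V \<le> (1 - s * \<epsilon> / 2) * card W" by (simp add: algebra_simps)
  also have "\<dots> \<le> card W" using eps mult_right_mono[of "1 - s * \<epsilon> / 2" 1 "card W"] by simp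
  finally have "2 ^ (s * T) * t < card W" using large by linarith
  moreover have "card (Pow U) * t \<le> 2 ^ (s * T) * t"
    using cU by (simp add: card_Pow finU)
  ultimately have "card (Pow U) * t < card W" by linarith
  moreover have "N ` W \<subseteq> Pow U" unfolding N_def by auto
  ultimately obtain Y where Y: "Y \<subseteq> U" "t < card {w \<in> W. N w = Y}"
    using large_fibre[of W "Pow U" N t] finW finU by auto
  obtain B0 where B0: "B0 \<subseteq> {w \<in> W. N w = Y}" "card B0 = t"
    using obtain_subset_with_card_n[of t "{w \<in> W. N w = Y}"] Y(2) by auto
  from Y(2) obtain w0 where "w0 \<in> W" "N w0 = Y"
    by (metis (mono_tags, lifting) card.empty empty_Collect_eq not_less_zero)
  then have "t \<le> card (A i \<inter> Y)" if "i < s" for i using that unfolding W_def by blast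
  then have "\<exists>B. B \<subseteq> A i \<inter> Y \<and> card B = t" if "i < s" for i
    using that by (meson obtain_subset_with_card_n)
  then obtain B where B: "\<And>i. i < s \<Longrightarrow> B i \<subseteq> A i \<inter> Y" "\<And>i. i < s \<Longrightarrow> card (B i) = t"
    by metis
  define C where "C i = (if i < s then B i else B0)" for i
  have BW: "{w, b} \<in> E" if "w \<in> B0" "b \<in> B i" "i < s" for w b i
    using that B0(1) B(1)[OF that(3)] unfolding N_def by blast
  have "C i \<subseteq> V \<and> card (C i) = t" if "i < Suc s" for i
  proof (cases "i < s")
    case True
    then show ?thesis using B[OF True] A(1)[OF True] unfolding C_def by auto
  next
    case False
    have "B0 \<subseteq> V" using B0(1) unfolding W_def by blast
    then show ?thesis using False B0(2) unfolding C_def by simp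
  qed
  moreover have "{a, b} \<in> E" if "i < Suc s" "j < Suc s" "i \<noteq> j" "a \<in> C i" "b \<in> C j" for i j a b
  proof -
    consider "i < s" "j < s" | "i < s" "j = s" | "i = s" "j < s"
      using \<open>i < Suc s\<close> \<open>j < Suc s\<close> \<open>i \<noteq> j\<close> unfolding less_Suc_eq by blast
    then show ?thesis
    proof cases
      case 1 then show ?thesis using AE[of i j a b] B(1) that unfolding C_def by auto
    next
      case 2 then show ?thesis using BW[of b a i] that unfolding C_def by (auto simp: insert_commute)
    next
      case 3 then show ?thesis using BW[of a b j] that unfolding C_def by auto
    qed
  qed
  ultimately show ?thesis unfolding has_partite_def by blast
qed

text \<open>The degree condition for \<open>Suc s\<close> implies the one for \<open>s\<close>, so
  the induction hypothesis supplies parts of a larger size \<open>T\<close>, from which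
  \<open>erdos_stone_step\<close> extracts one part more. In the base case any \<open>T\<close>-set
  is the single old part.\<close>

lemma erdos_stone_min_degree:
  fixes \<epsilon> :: real
  assumes "s \<ge> 1" and "\<epsilon> > 0"
  shows "\<exists>n0. \<forall>(V :: 'a set) E. finite V \<longrightarrow> n0 \<le> card V \<longrightarrow>
           (\<forall>v\<in>V. (1 - 1 / real s + \<epsilon>) * card V \<le> card {u \<in> V. {u, v} \<in> E}) \<longrightarrow>
           has_partite V E (Suc s) t"
  using assms
proof (induction s arbitrary: t \<epsilon> rule: nat_induct_at_least)
  case base
  \<comment> \<open>Both constants solve hypotheses of \<open>erdos_stone_step\<close>:
    \<open>T\<close> the bound on \<open>t\<close>, and \<open>n0\<close> the strict bound on
    \<open>2 ^ (s * T) * t\<close>. The latter also leaves room for a \<open>T\<close>-set.\<close>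
  define T where "T = Suc (max t (nat \<lceil>2 * t / \<epsilon>\<rceil>))"
  have T: "T \<ge> 1" "t \<le> T" "real t \<le> real 1 * \<epsilon> / 2 * T"
  proof -
    have "2 * t / \<epsilon> \<le> T" unfolding T_def by linarith
    with base show "real t \<le> real 1 * \<epsilon> / 2 * T" by (simp add: field_simps)
  qed (auto simp: T_def)
  define n0 where "n0 = Suc (max T (nat \<lceil>2 ^ T * t * 2 / \<epsilon>\<rceil>))"
  show ?case
  proof (intro exI[of _ n0] allI impI)
    fix V :: "'a set" and E
    assume V: "finite V" "n0 \<le> card V"
      "\<forall>v\<in>V. (1 - 1 / real 1 + \<epsilon>) * card V \<le> card {u \<in> V. {u, v} \<in> E}"
    obtain A where "A \<subseteq> V" "card A = T"
      using obtain_subset_with_card_n[of T V] V(2) unfolding n0_def by (metis Suc_leD max.bounded_iff)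
    then have "has_partite V E 1 T" unfolding has_partite_def by (intro exI[of _ "\<lambda>_. A"]) auto
    moreover have "2 ^ T * t * 2 / \<epsilon> < card V" using V(2) unfolding n0_def by linarith
    then have "real (2 ^ (1 * T) * t) < real 1 * \<epsilon> / 2 * card V" using base by (simp add: field_simps)
    ultimately show "has_partite V E (Suc 1) t"
      using erdos_stone_step[OF V(1), of 1 \<epsilon> E T t] V(3) T by auto
  qed
next
  case (Suc s)
  define r where "r = Suc s"
  define T where "T = Suc (max t (nat \<lceil>2 * t / (r * \<epsilon>)\<rceil>))"
  have r\<epsilon>: "r * \<epsilon> > 0" using Suc unfolding r_def by auto
  have T: "T \<ge> 1" "t \<le> T" "real t \<le> r * \<epsilon> / 2 * T"
  proof -
    have "2 * t / (r * \<epsilon>) \<le> T" unfolding T_def by linarith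
    with r\<epsilon> show "real t \<le> r * \<epsilon> / 2 * T" by (simp add: field_simps)
  qed (auto simp: T_def)
  obtain n1 where n1: "\<forall>(V :: 'a set) E. finite V \<longrightarrow> n1 \<le> card V \<longrightarrow>
           (\<forall>v\<in>V. (1 - 1 / real s + \<epsilon>) * card V \<le> card {u \<in> V. {u, v} \<in> E}) \<longrightarrow>
           has_partite V E (Suc s) T"
    using Suc.IH[OF \<open>\<epsilon> > 0\<close>] by (rule exE)
  define n0 where "n0 = Suc (max n1 (nat \<lceil>2 ^ (r * T) * t * 2 / (r * \<epsilon>)\<rceil>))"
  show ?case
  proof (intro exI[of _ n0] allI impI)
    fix V :: "'a set" and E
    assume V: "finite V" "n0 \<le> card V"
      "\<forall>v\<in>V. (1 - 1 / real (Suc s) + \<epsilon>) * card V \<le> card {u \<in> V. {u, v} \<in> E}"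
    have "1 / real (Suc s) \<le> 1 / real s" using Suc by (intro divide_left_mono) auto
    then have "(1 - 1 / real s + \<epsilon>) * card V \<le> card {u \<in> V. {u, v} \<in> E}" if "v \<in> V" for v
      using V(3)[rule_format, OF that] mult_right_mono[of "1 - 1 / real s + \<epsilon>" "1 - 1 / real (Suc s) + \<epsilon>" "card V"]
      by linarith
    then have "has_partite V E r T" using n1[rule_format, OF V(1)] V(2) unfolding n0_def r_def by auto
    moreover have "2 ^ (r * T) * t * 2 / (r * \<epsilon>) < card V" using V(2) unfolding n0_def by linarith
    then have "real (2 ^ (r * T) * t) < r * \<epsilon> / 2 * card V" using r\<epsilon> by (simp add: field_simps)
    ultimately show "has_partite V E (Suc (Suc s)) t"
      using erdos_stone_step[OF V(1), of r \<epsilon> E T t] V(3) T unfolding r_def by auto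
  qed
qed

text \<open>Passing to a subset \<open>S\<close> that maximises a potential turns density into
  minimum degree. \<open>S\<close> cannot be small: the potential of \<open>V\<close> is at least
  \<open>\<epsilon> / 4 * n\<^sup>2\<close>, and that of \<open>S\<close> is at most the square of
  \<open>card S\<close>.\<close>

theorem erdos_stone:
  fixes \<epsilon> :: real
  assumes "s \<ge> 1" and "\<epsilon> > 0"
  shows "\<exists>n0. \<forall>(V :: 'a set) E. finite V \<longrightarrow> n0 \<le> card V \<longrightarrow>
           (\<forall>e\<in>E. e \<subseteq> V \<and> card e = 2) \<longrightarrow>
           ((1 - 1 / real s) / 2 + \<epsilon>) * (card V)\<^sup>2 \<le> card E \<longrightarrow>
           has_partite V E (Suc s) t"
proof -
  obtain n1 where n1: "\<forall>(V :: 'a set) E. finite V \<longrightarrow> n1 \<le> card V \<longrightarrow>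
           (\<forall>v\<in>V. (1 - 1 / real s + \<epsilon>) * card V \<le> card {u \<in> V. {u, v} \<in> E}) \<longrightarrow>
           has_partite V E (Suc s) t"
    using erdos_stone_min_degree[OF assms] by (rule exE)
  define \<gamma> where "\<gamma> = 1 - 1 / real s + \<epsilon>"
  have "1 / real s \<le> 1" using assms by simp
  then have \<gamma>: "\<gamma> > 0" using assms unfolding \<gamma>_def by linarith
  \<comment> \<open>The first bound absorbs the linear term \<open>\<gamma> * n / 2\<close> into
    \<open>\<epsilon> / 4 * n\<^sup>2\<close>; the second gives
    \<open>n1 \<le> \<epsilon> / 4 * n\<close>, which together with \<open>n1 \<le> n\<close> forces
    \<open>n1 \<le> card S\<close>.\<close>
  define n0 where "n0 = Suc (max (nat \<lceil>2 * \<gamma> / \<epsilon>\<rceil>) (nat \<lceil>4 * real n1 / \<epsilon>\<rceil> + n1))"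
  show ?thesis
  proof (intro exI[of _ n0] allI impI)
    fix V :: "'a set" and E
    assume V: "finite V" "n0 \<le> card V" and E: "\<forall>e\<in>E. e \<subseteq> V \<and> card e = 2"
      and dens: "((1 - 1 / real s) / 2 + \<epsilon>) * (card V)\<^sup>2 \<le> card E"
    define n where "n = real (card V)"
    have n: "2 * \<gamma> / \<epsilon> < n" "4 * real n1 / \<epsilon> \<le> n" "n1 \<le> n" 
      using V(2) unfolding n0_def n_def by linarith+
    define E' where "E' S = {e \<in> E. e \<subseteq> S}" for S
    have finE: "finite E" using E V(1) by (meson PowI finite_Pow_iff finite_subset subsetI)
    \<comment> \<open>A maximiser of \<open>f\<close> has large minimum degree, since deleting a vertex must not increase \<open>f\<close>.\<close>
    define f where "f S = card (E' S) - \<gamma> * (real (card S) * (real (card S) + 1) / 2)" for S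
    obtain S where S: "S \<subseteq> V" and max: "\<And>S'. S' \<subseteq> V \<Longrightarrow> f S' \<le> f S"
    proof -
      have "finite (f ` Pow V)" "f ` Pow V \<noteq> {}" using V(1) by auto
      from Max_in[OF this] obtain S where "S \<subseteq> V" "f S = Max (f ` Pow V)" by auto
      with that[of S] show ?thesis using Max_ge[OF \<open>finite (f ` Pow V)\<close>] by auto
    qed
    have finS: "finite S" using S V(1) finite_subset by auto
    have deg: "\<gamma> * card S \<le> card {u \<in> S. {u, v} \<in> E}" if v: "v \<in> S" for v
    proof -
      have "E' S = E' (S - {v}) \<union> (\<lambda>u. {u, v}) ` {u \<in> S. {u, v} \<in> E}"
      proof (intro equalityI subsetI)
        fix e assume e: "e \<in> E' S"
        show "e \<in> E' (S - {v}) \<union> (\<lambda>u. {u, v}) ` {u \<in> S. {u, v} \<in> E}"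
        proof (cases "v \<in> e")
          case True
          have "card e = 2" using e E unfolding E'_def by auto
          then obtain a b where "e = {a, b}" "a \<noteq> b" by (auto simp: card_2_iff)
          with True have "\<exists>u. e = {u, v}" by auto
          then show ?thesis using e unfolding E'_def by auto
        qed (use e in \<open>auto simp: E'_def\<close>)
      qed (use v in \<open>auto simp: E'_def\<close>)
      then have "card (E' S) \<le> card (E' (S - {v})) + card ((\<lambda>u. {u, v}) ` {u \<in> S. {u, v} \<in> E})"
        by (metis card_Un_le)
      also have "\<dots> \<le> card (E' (S - {v})) + card {u \<in> S. {u, v} \<in> E}"
        using finS by (simp add: card_image_le)
      finally have 1: "card (E' S) \<le> card (E' (S - {v})) + card {u \<in> S. {u, v} \<in> E}" .
      have 2: "f (S - {v}) \<le> f S" using S by (intro max) auto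
      have 3: "real (card (S - {v})) = real (card S) - 1"
        using v finS by (simp add: card_Diff_singleton Suc_leI card_gt_0_iff of_nat_diff)
          (metis One_nat_def Suc_leI card_gt_0_iff empty_iff of_nat_1 of_nat_diff)
      have "real (card (E' S)) \<le> card (E' (S - {v})) + card {u \<in> S. {u, v} \<in> E}"
        using 1 of_nat_mono by fastforce
      with 2 show ?thesis unfolding f_def 3 by (simp add: algebra_simps add_divide_distrib diff_divide_distrib)
    qed
    have EV: "E' V = E" using E unfolding E'_def by auto
    have "card (E' S) \<le> (card S)\<^sup>2"
    proof -
      have "E' S \<subseteq> (\<lambda>(u, v). {u, v}) ` (S \<times> S)"
      proof
        fix e assume e: "e \<in> E' S"
        then have "card e = 2" using E unfolding E'_def by auto
        then show "e \<in> (\<lambda>(u, v). {u, v}) ` (S \<times> S)"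
          using e unfolding E'_def by (auto simp: card_2_iff)
      qed
      then have "card (E' S) \<le> card (S \<times> S)" using finS by (intro surj_card_le[where f = "\<lambda>(u, v). {u, v}"]) auto
      then show ?thesis by (simp add: power2_eq_square card_cartesian_product)
    qed
    then have "f S \<le> (real (card S))\<^sup>2" using \<gamma> unfolding f_def
      by (smt (verit) of_nat_le_iff of_nat_power mult_nonneg_nonneg of_nat_0_le_iff divide_nonneg_nonneg)
    moreover have "f V \<le> f S" by (intro max) auto
    moreover have "\<epsilon> / 4 * n\<^sup>2 \<le> f V"
    proof -
      \<comment> \<open>Half of the surplus \<open>\<epsilon>\<close> is contained in
        \<open>\<gamma> / 2\<close>; the other half pays for the linear term and for the size of
        \<open>S\<close>.\<close>
      have "(1 - 1 / real s) / 2 + \<epsilon> = \<gamma> / 2 + \<epsilon> / 2" unfolding \<gamma>_def by (simp add: field_simps)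
      then have "f V \<ge> (\<gamma> / 2 + \<epsilon> / 2) * n\<^sup>2 - \<gamma> * (n * (n + 1) / 2)"
        using dens unfolding f_def EV n_def by simp
      also have "(\<gamma> / 2 + \<epsilon> / 2) * n\<^sup>2 - \<gamma> * (n * (n + 1) / 2) = \<epsilon> / 2 * n\<^sup>2 - \<gamma> * n / 2"
        by (simp add: power2_eq_square field_simps)
      finally have "\<epsilon> / 2 * n\<^sup>2 - \<gamma> * n / 2 \<le> f V" .
      moreover have "\<gamma> * 2 < n * \<epsilon>" using n(1) assms(2) by (simp add: field_simps)
      then have "\<gamma> * 2 * n \<le> n * \<epsilon> * n" by (intro mult_right_mono) (auto simp: n_def)
      then have "\<gamma> * n / 2 \<le> \<epsilon> / 4 * n\<^sup>2" by (simp add: power2_eq_square field_simps)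
      ultimately show ?thesis by linarith
    qed
    ultimately have cS: "\<epsilon> / 4 * n\<^sup>2 \<le> (real (card S))\<^sup>2" by linarith
    have "n1 \<le> card S"
    proof (rule ccontr)
      assume *: "\<not> n1 \<le> card S"
      then have "(real (card S))\<^sup>2 < (real n1)\<^sup>2" by (intro power_strict_mono) auto
      moreover have "real n1 \<le> \<epsilon> / 4 * n" using n(2) assms(2) by (simp add: field_simps)
      then have "real n1 * real n1 \<le> (\<epsilon> / 4 * n) * n" using n(3) by (intro mult_mono) auto
      ultimately show False using cS by (simp add: power2_eq_square)
    qed
    then have "has_partite S E (Suc s) t"
      using n1[rule_format, OF finS] deg unfolding \<gamma>_def by blast
    then show "has_partite V E (Suc s) t" using has_partite_mono[OF _ S] by blast
  qed
qed

section \<open>Copies in multipartite graphs\<close>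

text \<open>A union bound. By \<open>X_upd\<close> the places forbidden to \<open>v\<close> do not
  depend on the value at \<open>v\<close>, so a map that is bad at \<open>v\<close> is given by its
  other values and one of at most \<open>K\<close> choices. There are at most
  \<open>card I * K * T ^ (card I - 1)\<close> bad maps, fewer than the \<open>T ^ card I\<close>
  maps in all.\<close>

lemma ex_transversal_embedding:
  fixes A :: "'b \<Rightarrow> 'a set" and X :: "'b \<Rightarrow> ('b \<Rightarrow> 'a) \<Rightarrow> 'a set"
  assumes I: "finite I" and A: "\<And>v. v \<in> I \<Longrightarrow> card (A v) = T" and T: "card I * K < T"
    and X: "\<And>v g. v \<in> I \<Longrightarrow> g \<in> Pi\<^sub>E (I - {v}) A \<Longrightarrow> finite (X v g) \<and> card (X v g) \<le> K"
    and X_upd: "\<And>v g y. v \<in> I \<Longrightarrow> X v (g(v := y)) = X v g"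
  shows "\<exists>f\<in>Pi\<^sub>E I A. \<forall>v\<in>I. f v \<notin> X v f"
proof (cases "I = {}")
  case False
  have finA: "finite (A v)" if "v \<in> I" for v
    using A[OF that] T card.infinite by fastforce
  define Bad where "Bad v = {f \<in> Pi\<^sub>E I A. f v \<in> X v f}" for v
  have finPi: "finite (Pi\<^sub>E I A)" using I finA by (intro finite_PiE) auto
  have cPi: "card (Pi\<^sub>E I A) = T ^ card I" using I A by (simp add: card_PiE)
  have bad: "card (Bad v) \<le> T ^ (card I - 1) * K" if v: "v \<in> I" for v
  proof -
    let ?P = "Pi\<^sub>E (I - {v}) A"
    have finP: "finite ?P" using I finA by (intro finite_PiE) auto
    have "Bad v \<subseteq> (\<lambda>(g, y). g(v := y)) ` (SIGMA g:?P. X v g)"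
    proof
      fix f assume f: "f \<in> Bad v"
      define g where "g = restrict f (I - {v})"
      have fg: "f = g(v := f v)" using f v unfolding Bad_def g_def by (auto simp: fun_eq_iff PiE_def extensional_def)
      have "g \<in> ?P" using f unfolding Bad_def g_def by auto
      moreover have "f v \<in> X v g" using f X_upd[OF v, of g "f v"] fg unfolding Bad_def by auto
      ultimately show "f \<in> (\<lambda>(g, y). g(v := y)) ` (SIGMA g:?P. X v g)"
        using fg by (auto intro!: image_eqI[of _ _ "(g, f v)"])
    qed
    then have "card (Bad v) \<le> card (SIGMA g:?P. X v g)"
      using finP X[OF v] by (intro surj_card_le) auto
    also have "\<dots> = (\<Sum>g\<in>?P. card (X v g))"
      using finP X[OF v] by (intro card_SigmaI) auto
    also have "\<dots> \<le> card ?P * K"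
      using sum_bounded_above[of ?P "\<lambda>g. card (X v g)" K] X[OF v] by simp
    also have "card ?P = T ^ (card I - 1)" using I A v by (simp add: card_PiE)
    finally show ?thesis .
  qed
  have "card (\<Union>v\<in>I. Bad v) \<le> (\<Sum>v\<in>I. card (Bad v))" using I by (rule card_UN_le)
  also have "\<dots> \<le> card I * (T ^ (card I - 1) * K)"
    using sum_bounded_above[of I "\<lambda>v. card (Bad v)"] bad by simp
  also have "\<dots> = T ^ (card I - 1) * (card I * K)" by simp
  also have "\<dots> < T ^ (card I - 1) * T" using T by simp
  also have "\<dots> = T ^ card I" using False I by (simp add: card_gt_0_iff flip: power_Suc2)
  finally have "card (\<Union>v\<in>I. Bad v) < card (Pi\<^sub>E I A)" unfolding cPi .
  moreover have "finite (\<Union>v\<in>I. Bad v)" using finPi I unfolding Bad_def by simp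
  ultimately have "\<not> Pi\<^sub>E I A \<subseteq> (\<Union>v\<in>I. Bad v)" using card_mono leD by blast
  then show ?thesis unfolding Bad_def by blast
qed auto

lemma edge_cases:
  assumes "simple_graph G" and "e \<in> edges G"
  obtains u v where "e = {u, v}" and "u \<noteq> v" and "u \<in> verts G" and "v \<in> verts G"
  using assms unfolding simple_graph_def by (metis card_2_iff insert_subset)

lemma finite_edges: "simple_graph G \<Longrightarrow> finite (edges G)"
  unfolding simple_graph_def by (meson PowI finite_Pow_iff finite_subset subsetI)

text \<open>\<open>W x\<close> holds the places that a host edge \<open>x\<close> forbids to all
  vertices off it: none for ordinary copies, and the vertex set of the packed copy through
  \<open>x\<close> for rainbow copies. Injectivity comes from the same count, by forbidding to each
  vertex the images of the others.\<close>

lemma embed_in_partite: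
  fixes G :: "'b graph" and E :: "'a set set" and W :: "'a set \<Rightarrow> 'a set"
  assumes G: "simple_graph G" and col: "proper_coloring G r c"
    and part: "has_partite V E r T"
    and W: "\<And>e. finite (W e) \<and> card (W e) \<le> k"
    and T: "card (verts G) * (card (verts G) + num_edges G * k) < T"
  obtains f where "inj_on f (verts G)" and "f ` verts G \<subseteq> V" and "\<And>e. e \<in> edges G \<Longrightarrow> f ` e \<in> E"
    and "\<And>e v. e \<in> edges G \<Longrightarrow> v \<in> verts G - e \<Longrightarrow> f v \<notin> W (f ` e)"
proof -
  have fin: "finite (verts G)" "finite (edges G)" using G finite_edges unfolding simple_graph_def by auto
  obtain A where A: "\<And>i. i < r \<Longrightarrow> A i \<subseteq> V" "\<And>i. i < r \<Longrightarrow> card (A i) = T"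
    and AE: "\<And>i j a b. i < r \<Longrightarrow> j < r \<Longrightarrow> i \<noteq> j \<Longrightarrow> a \<in> A i \<Longrightarrow> b \<in> A j \<Longrightarrow> {a, b} \<in> E"
    using part unfolding has_partite_def by metis
  have c: "c v < r" if "v \<in> verts G" for v using col that unfolding proper_coloring_def by auto
  \<comment> \<open>Only edges avoiding \<open>v\<close> contribute, so that \<open>X v g\<close> is
    unaffected by the value of \<open>g\<close> at \<open>v\<close>.\<close>
  define X where "X v g = g ` (verts G - {v}) \<union> (\<Union>e\<in>{e \<in> edges G. v \<notin> e}. W (g ` e))" for v and g :: "'b \<Rightarrow> 'a"
  have "\<exists>f\<in>Pi\<^sub>E (verts G) (A \<circ> c). \<forall>v\<in>verts G. f v \<notin> X v f"
  proof (rule ex_transversal_embedding[OF fin(1) _ T])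
    fix v g assume v: "v \<in> verts G"
    show "card ((A \<circ> c) v) = T" using A(2)[OF c[OF v]] by simp
    have "card (X v g) \<le> card (g ` (verts G - {v})) + card (\<Union>e\<in>{e \<in> edges G. v \<notin> e}. W (g ` e))"
      unfolding X_def by (rule card_Un_le)
    also have "card (g ` (verts G - {v})) \<le> card (verts G)"
      using fin by (meson Diff_subset card_image_le card_mono finite_Diff order_trans)
    also have "card (\<Union>e\<in>{e \<in> edges G. v \<notin> e}. W (g ` e)) \<le> (\<Sum>e\<in>{e \<in> edges G. v \<notin> e}. card (W (g ` e)))"
      using fin by (intro card_UN_le) auto
    also have "\<dots> \<le> (\<Sum>e\<in>edges G. card (W (g ` e)))" using fin by (intro sum_mono2) auto
    also have "\<dots> \<le> num_edges G * k"
      using sum_bounded_above[of "edges G" "\<lambda>e. card (W (g ` e))" k] W unfolding num_edges_def by simp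
    finally show "finite (X v g) \<and> card (X v g) \<le> card (verts G) + num_edges G * k"
      using fin W unfolding X_def by auto
    show "X v (g(v := y)) = X v g" for y
    proof -
      have "g(v := y) ` e = g ` e" if "v \<notin> e" for e using that by (auto simp: image_def)
      then show ?thesis unfolding X_def by auto
    qed
  qed
  then obtain f where f: "f \<in> Pi\<^sub>E (verts G) (A \<circ> c)" "\<And>v. v \<in> verts G \<Longrightarrow> f v \<notin> X v f" by auto
  show thesis
  proof
    show "inj_on f (verts G)"
    proof (rule inj_onI, rule ccontr)
      fix u v assume uv: "u \<in> verts G" "v \<in> verts G" "f u = f v" "u \<noteq> v"
      then have "f u \<in> f ` (verts G - {u})" by auto
      with f(2)[OF uv(1)] show False unfolding X_def by simp
    qed
    show "f ` verts G \<subseteq> V" using PiE_mem[OF f(1)] A(1)[OF c] by auto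
    show "f ` e \<in> E" if e: "e \<in> edges G" for e
    proof -
      obtain u v where uv: "e = {u, v}" "u \<in> verts G" "v \<in> verts G" using edge_cases[OF G e] by metis
      then have "c u \<noteq> c v" using col e unfolding proper_coloring_def by auto
      then have "{f u, f v} \<in> E" using AE[of "c u" "c v" "f u" "f v"] c uv PiE_mem[OF f(1)] by auto
      then show ?thesis using uv by simp
    qed
    show "f v \<notin> W (f ` e)" if "e \<in> edges G" "v \<in> verts G - e" for e v
      using f(2)[of v] that unfolding X_def by auto
  qed
qed

section \<open>Images of graphs, chromatic number and isomorphism invariants\<close>

definition image_graph :: "('b \<Rightarrow> 'a) \<Rightarrow> 'b graph \<Rightarrow> 'a graph" where
  "image_graph f G = Graph (f ` verts G) ((`) f ` edges G)"

lemma image_graph_sel [simp]: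
  "verts (image_graph f G) = f ` verts G" "edges (image_graph f G) = (`) f ` edges G"
  unfolding image_graph_def by auto

lemma simple_image_graph:
  assumes "simple_graph G" and "inj_on f (verts G)"
  shows "simple_graph (image_graph f G)"
  using assms unfolding simple_graph_def
  by (auto intro: inj_on_subset simp: card_image[OF inj_on_subset[OF assms(2)]])

lemma isomorphic_image_graph:
  assumes G: "simple_graph G" and f: "inj_on f (verts G)"
  shows "isomorphic (image_graph f G) G"
  unfolding isomorphic_def
proof (intro exI conjI ballI)
  let ?g = "the_inv_into (verts G) f"
  show "bij_betw ?g (verts (image_graph f G)) (verts G)"
    using f by (simp add: bij_betw_the_inv_into inj_on_imp_bij_betw)
  fix x y assume "x \<in> verts (image_graph f G)" "y \<in> verts (image_graph f G)"
  then obtain u v where uv: "x = f u" "y = f v" "u \<in> verts G" "v \<in> verts G" by auto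
  have "{f u, f v} \<in> (`) f ` edges G \<longleftrightarrow> {u, v} \<in> edges G"
  proof
    assume "{f u, f v} \<in> (`) f ` edges G"
    then obtain e where e: "e \<in> edges G" "f ` e = f ` {u, v}" by auto
    then have "e \<subseteq> verts G" using G unfolding simple_graph_def by auto
    then have "e = {u, v}" using inj_on_image_eq_iff[OF f, of e "{u, v}"] uv e(2) by auto
    then show "{u, v} \<in> edges G" using e by simp
  qed (auto intro!: image_eqI[of _ _ "{u, v}"])
  then show "{x, y} \<in> edges (image_graph f G) \<longleftrightarrow> {?g x, ?g y} \<in> edges G"
    using uv f by (simp add: the_inv_into_f_f)
qed

text \<open>Numbering the vertices injectively is a proper coloring, so the \<open>LEAST\<close> in
  \<open>chromatic_number\<close> is attained.\<close>

lemma proper_coloring_chromatic_number: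
  assumes G: "simple_graph G"
  shows "\<exists>c. proper_coloring G (chromatic_number G) c"
  unfolding chromatic_number_def
proof (rule LeastI_ex)
  obtain h where h: "bij_betw h (verts G) {0..<card (verts G)}"
    using G ex_bij_betw_finite_nat unfolding simple_graph_def by blast
  have "h u \<noteq> h v" if "{u, v} \<in> edges G" for u v
  proof -
    have "u \<noteq> v" "u \<in> verts G" "v \<in> verts G" using edge_cases[OF G that] by (metis doubleton_eq_iff)+
    then show ?thesis using h unfolding bij_betw_def inj_on_def by auto
  qed
  then have "proper_coloring G (card (verts G)) h"
    using h unfolding proper_coloring_def bij_betw_def by auto
  then show "\<exists>k c. proper_coloring G k c" by blast
qed

lemma proper_coloring_mono: "proper_coloring G k c \<Longrightarrow> k \<le> l \<Longrightarrow> proper_coloring G l c"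
  unfolding proper_coloring_def by fastforce

lemma chromatic_number_ge_2:
  assumes G: "simple_graph G" and "edges G \<noteq> {}"
  shows "2 \<le> chromatic_number G"
proof -
  obtain c where c: "proper_coloring G (chromatic_number G) c"
    using proper_coloring_chromatic_number[OF G] by auto
  obtain e where e: "e \<in> edges G" using assms by auto
  obtain u v where uv: "e = {u, v}" "u \<in> verts G" "v \<in> verts G" using edge_cases[OF G e] by metis
  then have "c u < chromatic_number G" "c v < chromatic_number G" "c u \<noteq> c v"
    using c e unfolding proper_coloring_def by auto
  then show ?thesis by linarith
qed

text \<open>Composing \<open>p\<close> with the inverse of the isomorphism would colour
  \<open>G\<close> with \<open>s\<close> colours. This is what keeps the multipartite packings free
  of \<open>G\<close>.\<close>

lemma no_copy_of_larger_chromatic_number: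
  assumes H: "\<And>v. v \<in> verts H \<Longrightarrow> p v < s" "\<And>u v. {u, v} \<in> edges H \<Longrightarrow> p u \<noteq> p v"
    and G: "simple_graph G" and s: "s < chromatic_number G"
  shows "\<not> (subgraph G' H \<and> isomorphic G' G)"
proof
  assume *: "subgraph G' H \<and> isomorphic G' G"
  then obtain f where f: "bij_betw f (verts G') (verts G)"
    and fe: "\<And>u v. u \<in> verts G' \<Longrightarrow> v \<in> verts G' \<Longrightarrow> {u, v} \<in> edges G' \<longleftrightarrow> {f u, f v} \<in> edges G"
    unfolding isomorphic_def by blast
  let ?g = "the_inv_into (verts G') f"
  have g: "?g v \<in> verts G'" "f (?g v) = v" if "v \<in> verts G" for v
    using f that by (auto simp: bij_betw_def the_inv_into_into f_the_inv_into_f)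
  have "proper_coloring G s (p \<circ> ?g)"
    unfolding proper_coloring_def
  proof (intro conjI ballI allI impI)
    show "(p \<circ> ?g) v < s" if "v \<in> verts G" for v
      using H(1) g that * unfolding subgraph_def by auto
    fix u v assume e: "{u, v} \<in> edges G"
    then have "u \<in> verts G" "v \<in> verts G" using G unfolding simple_graph_def by auto
    then have "{?g u, ?g v} \<in> edges G'" using fe g e by auto
    then show "(p \<circ> ?g) u \<noteq> (p \<circ> ?g) v" using H(2) * unfolding subgraph_def by auto
  qed
  then have "chromatic_number G \<le> s" unfolding chromatic_number_def by (intro Least_le) auto
  with s show False by simp
qed

lemma isomorphic_card:
  assumes "isomorphic H K" and "simple_graph H" and "simple_graph K"
  shows "card (verts H) = card (verts K)" and "num_edges H = num_edges K"
proof -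
  obtain f where f: "bij_betw f (verts H) (verts K)"
    and fe: "\<And>u v. u \<in> verts H \<Longrightarrow> v \<in> verts H \<Longrightarrow> {u, v} \<in> edges H \<longleftrightarrow> {f u, f v} \<in> edges K"
    using assms(1) unfolding isomorphic_def by blast
  show "card (verts H) = card (verts K)" using f by (rule bij_betw_same_card)
  have "(`) f ` edges H = edges K"
  proof (intro equalityI subsetI)
    fix x assume "x \<in> (`) f ` edges H"
    then obtain e where e: "e \<in> edges H" "x = f ` e" by auto
    obtain u v where "e = {u, v}" "u \<in> verts H" "v \<in> verts H" using edge_cases[OF assms(2) e(1)] by metis
    then show "x \<in> edges K" using fe e by auto
  next
    fix x assume x: "x \<in> edges K"
    obtain a b where ab: "x = {a, b}" "a \<in> verts K" "b \<in> verts K" using edge_cases[OF assms(3) x] by metis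
    then obtain u v where uv: "a = f u" "b = f v" "u \<in> verts H" "v \<in> verts H"
      using f unfolding bij_betw_def by blast
    then have "{u, v} \<in> edges H" using fe ab x by auto
    then show "x \<in> (`) f ` edges H" using ab uv by (auto intro!: image_eqI[of _ _ "{u, v}"])
  qed
  moreover have "inj_on ((`) f) (edges H)"
  proof (rule inj_on_subset[OF inj_on_image_Pow])
    show "inj_on f (verts H)" using f unfolding bij_betw_def by simp
    show "edges H \<subseteq> Pow (verts H)" using assms(2) unfolding simple_graph_def by auto
  qed
  ultimately show "num_edges H = num_edges K"
    unfolding num_edges_def using card_image by metis
qed

section \<open>Algebraic packings\<close>

text \<open>The character \<open>\<kappa>\<close> is \<open>pos_prod / neg_prod\<close>. There are four coordinates for each edge,
  with alternating signs, so that \<open>\<kappa>(-z) = \<kappa>(z)\<close> and edges need no orientation.\<close>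

definition pos_prod :: "'e set \<Rightarrow> ('e \<times> bool \<times> bool \<Rightarrow> int) \<Rightarrow> int" where
  "pos_prod E z = (\<Prod>e\<in>E. z (e, True, True) * z (e, False, False))"

definition neg_prod :: "'e set \<Rightarrow> ('e \<times> bool \<times> bool \<Rightarrow> int) \<Rightarrow> int" where
  "neg_prod E z = (\<Prod>e\<in>E. z (e, True, False) * z (e, False, True))"

lemma pos_prod_mult: "pos_prod E (\<lambda>i. a i * y i) = pos_prod E a * pos_prod E y"
  and neg_prod_mult: "neg_prod E (\<lambda>i. a i * y i) = neg_prod E a * neg_prod E y"
  unfolding pos_prod_def neg_prod_def by (simp_all add: mult_ac flip: prod.distrib)

lemma pos_prod_cong:
  assumes "\<And>i. i \<in> E \<times> UNIV \<Longrightarrow> [z i = z' i] (mod p)"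
  shows "[pos_prod E z = pos_prod E z'] (mod p)" and "[neg_prod E z = neg_prod E z'] (mod p)"
  unfolding pos_prod_def neg_prod_def using assms by (auto intro!: cong_prod cong_mult)

lemma prime_not_dvd_pos_prod:
  assumes "prime p" and "finite E" and "\<And>i. i \<in> E \<times> UNIV \<Longrightarrow> \<not> p dvd z i"
  shows "\<not> p dvd pos_prod E z"
  using assms unfolding pos_prod_def by (auto simp: prime_dvd_prod_iff prime_dvd_mult_iff)

lemma not_dvd_diff_of_range:
  fixes a b p :: int
  assumes "a \<noteq> b" and "0 \<le> a" and "a < p" and "0 \<le> b" and "b < p"
  shows "\<not> p dvd a - b"
  using assms by (metis mod_eq_dvd_iff mod_pos_pos_trivial)

text \<open>The quotient of the two products is the factor that the four coordinates of
  \<open>e\<close> contribute to \<open>\<kappa>\<close> at a label difference: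
  \<open>\<xi> / (2 * (\<xi> - 1))\<close> on the edge \<open>e\<close>, and 1 on every other pair.
  With denominators cleared these are identities between integers, valid before any reduction modulo
  \<open>p\<close>.\<close>

definition edge_labels ::
  "'a set \<Rightarrow> int \<Rightarrow> 'a set \<Rightarrow> int \<Rightarrow> (bool \<times> bool \<Rightarrow> 'a \<Rightarrow> int) \<Rightarrow> bool" where
  "edge_labels V p e \<xi> l \<longleftrightarrow>
    (\<forall>k. \<forall>w\<in>V. \<forall>w'\<in>V. w \<noteq> w' \<longrightarrow> \<not> p dvd l k w - l k w') \<and>
    (\<forall>w w'. {w, w'} = e \<longrightarrow>
       (l (True, True) w - l (True, True) w') * (l (False, False) w - l (False, False) w') * (2 * (\<xi> - 1)) =
       \<xi> * ((l (True, False) w - l (True, False) w') * (l (False, True) w - l (False, True) w'))) \<and>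
    (\<forall>w w'. w \<noteq> w' \<longrightarrow> {w, w'} \<noteq> e \<longrightarrow>
       (l (True, True) w - l (True, True) w') * (l (False, False) w - l (False, False) w') =
       (l (True, False) w - l (True, False) w') * (l (False, True) w - l (False, True) w'))"

text \<open>The four labellings move \<open>u0\<close> between \<open>\<xi>\<close> and \<open>2\<close> and \<open>v0\<close> between \<open>0\<close> and \<open>1\<close>;
  in the alternating product only the pair \<open>u0, v0\<close> survives, with the cross ratio of these
  four numbers.\<close>

lemma ex_edge_labels:
  fixes p \<xi> :: int
  assumes V: "finite V" and p: "card V + 4 \<le> p" and u0: "u0 \<noteq> v0"
    and \<xi>: "2 \<le> \<xi>" "\<xi> < p"
  shows "\<exists>l. edge_labels V p {u0, v0} \<xi> l"
proof -
  \<comment> \<open>The removed residues are reserved for \<open>u0\<close> and \<open>v0\<close>;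
    the other vertices get distinct labels from the rest, the same in all four labellings. This is
    the origin of \<open>card V + 4\<close>.\<close>
  let ?Q = "{0..<p} - {0, 1, 2, \<xi>}"
  have "card {0, 1, 2, \<xi>} \<le> 4" by (simp add: card_insert_if)
  moreover have "card {0..<p} - card {0, 1, 2, \<xi>} \<le> card ?Q" by (rule diff_card_le_card_Diff) simp
  ultimately have "card V \<le> card ?Q" using p by simp
  then obtain b where b: "inj_on b V" "b ` V \<subseteq> ?Q" using card_le_inj[OF V, of ?Q] by auto
  define l where "l k w = (if w = u0 then (if fst k then \<xi> else 2)
                           else if w = v0 then (if snd k then 0 else 1) else b w)" for k :: "bool \<times> bool" and w
  have range: "0 \<le> l k w \<and> l k w < p" if "w \<in> V" for k w
    using b(2) \<xi> p that unfolding l_def by (auto simp: image_subset_iff)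
  have inj: "l k w \<noteq> l k w'" if "w \<in> V" "w' \<in> V" "w \<noteq> w'" for k w w'
  proof -
    have "b w \<notin> {0, 1, 2, \<xi>}" "b w' \<notin> {0, 1, 2, \<xi>}" using b(2) that by auto
    moreover have "b w \<noteq> b w'" using b(1) that unfolding inj_on_def by auto
    ultimately show ?thesis using \<xi> that unfolding l_def by auto
  qed
  show ?thesis
    unfolding edge_labels_def
  proof (intro exI[of _ l] conjI allI ballI impI)
    show "\<not> p dvd l k w - l k w'" if "w \<in> V" "w' \<in> V" "w \<noteq> w'" for k w w'
      using not_dvd_diff_of_range[OF inj[OF that]] range that by blast
  qed (use u0 in \<open>auto simp: l_def doubleton_eq_iff algebra_simps\<close>)
qed

text \<open>The labellings for the single edges are placed side by side as coordinates. Those of an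
  edge other than \<open>{u, v}\<close> contribute equally to both products at
  \<open>a u - a v\<close>, so each edge receives its class independently of the others.\<close>

lemma ex_labels:
  fixes p :: int and \<xi> :: "'a set \<Rightarrow> int"
  assumes F: "simple_graph F" and p: "card (verts F) + 4 \<le> p"
    and \<xi>: "\<And>e. e \<in> edges F \<Longrightarrow> 2 \<le> \<xi> e \<and> \<xi> e < p"
  shows "\<exists>a :: 'a \<Rightarrow> 'a set \<times> bool \<times> bool \<Rightarrow> int.
    (\<forall>u\<in>verts F. \<forall>v\<in>verts F. u \<noteq> v \<longrightarrow> (\<forall>i\<in>edges F \<times> UNIV. \<not> p dvd a u i - a v i)) \<and>
    (\<forall>u v. {u, v} \<in> edges F \<longrightarrow>
       pos_prod (edges F) (\<lambda>i. a u i - a v i) * (2 * (\<xi> {u, v} - 1)) =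
       \<xi> {u, v} * neg_prod (edges F) (\<lambda>i. a u i - a v i))"
proof -
  have fin: "finite (verts F)" "finite (edges F)" using F finite_edges unfolding simple_graph_def by auto
  have "\<exists>l. edge_labels (verts F) p e (\<xi> e) l" if e: "e \<in> edges F" for e
  proof -
    obtain u v where uv: "e = {u, v}" "u \<noteq> v" using edge_cases[OF F e] by metis
    show ?thesis using ex_edge_labels[OF fin(1) p uv(2), of "\<xi> e"] \<xi>[OF e] uv(1) by simp
  qed
  then obtain l where l: "\<And>e. e \<in> edges F \<Longrightarrow> edge_labels (verts F) p e (\<xi> e) (l e)" by metis
  note l = l[unfolded edge_labels_def]
  define a where "a w i = l (fst i) (snd i) w" for w i
  show ?thesis
  proof (intro exI[of _ a] conjI ballI allI impI)
    show "\<not> p dvd a u i - a v i" if "u \<in> verts F" "v \<in> verts F" "u \<noteq> v" "i \<in> edges F \<times> UNIV" for u v i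
      using that l[of "fst i"] unfolding a_def by auto
    fix u v assume e: "{u, v} \<in> edges F"
    define e where "e = {u, v}"
    have "u \<noteq> v" using edge_cases[OF F e] by (metis doubleton_eq_iff)
    then have rest: "(\<Prod>d\<in>edges F - {e}. (a u (d, True, True) - a v (d, True, True)) * (a u (d, False, False) - a v (d, False, False)))
      = (\<Prod>d\<in>edges F - {e}. (a u (d, True, False) - a v (d, True, False)) * (a u (d, False, True) - a v (d, False, True)))"
      using l unfolding a_def e_def by (intro prod.cong refl) (simp, blast)
    have "(a u (e, True, True) - a v (e, True, True)) * (a u (e, False, False) - a v (e, False, False)) * (2 * (\<xi> e - 1)) =
        \<xi> e * ((a u (e, True, False) - a v (e, True, False)) * (a u (e, False, True) - a v (e, False, True)))"
      using l[OF e] unfolding a_def e_def fst_conv snd_conv by blast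
    from arg_cong[OF this, of "\<lambda>x. x * (\<Prod>d\<in>edges F - {e}. (a u (d, True, False) - a v (d, True, False)) * (a u (d, False, True) - a v (d, False, True)))"]
    show "pos_prod (edges F) (\<lambda>i. a u i - a v i) * (2 * (\<xi> {u, v} - 1)) =
       \<xi> {u, v} * neg_prod (edges F) (\<lambda>i. a u i - a v i)"
      unfolding pos_prod_def neg_prod_def e_def[symmetric]
        prod.remove[OF fin(2) e[folded e_def]] rest by (simp only: mult_ac)
  qed
qed

text \<open>All coordinates except \<open>i0\<close> can be chosen freely; balance is then a linear
  congruence for the last one with invertible coefficient \<open>P\<close>. Its solution is nonzero
  because \<open>neg_prod\<close> is prime to \<open>p\<close>.\<close>

lemma card_balanced_ge:
  fixes p :: int
  assumes p: "prime p" and E: "finite E" "E \<noteq> {}"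
  shows "(nat p - 1) ^ (4 * card E - 1) \<le>
    card {y \<in> Pi\<^sub>E (E \<times> UNIV) (\<lambda>_. {1..<p}). [pos_prod E y = neg_prod E y] (mod p)}" (is "_ \<le> card ?Y")
proof -
  obtain e0 where e0: "e0 \<in> E" using E by auto
  define i0 where "i0 = (e0, True, True)"
  let ?I = "E \<times> (UNIV :: (bool \<times> bool) set)"
  have finI: "finite ?I" using E by auto
  have cI: "card ?I = 4 * card E" by (simp add: card_cartesian_product flip: UNIV_Times_UNIV)
  have i0: "i0 \<in> ?I" using e0 unfolding i0_def by auto
  have finY: "finite ?Y" using finI by (intro finite_subset[OF _ finite_PiE[of ?I "\<lambda>_. {1..<p}"]]) auto
  have "Pi\<^sub>E (?I - {i0}) (\<lambda>_. {1..<p}) \<subseteq> (\<lambda>y. restrict y (?I - {i0})) ` ?Y"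
  proof
    fix f assume f: "f \<in> Pi\<^sub>E (?I - {i0}) (\<lambda>_. {1..<p})"
    define g where "g t = f(i0 := t)" for t
    have nd: "\<not> p dvd f i" if "i \<in> ?I" "i \<noteq> i0" for i
      using f that zdvd_not_zless[of "f i" p] by (fastforce simp: PiE_def Pi_def)
    define P where "P = f (e0, False, False) * (\<Prod>e\<in>E - {e0}. f (e, True, True) * f (e, False, False))"
    have pos: "pos_prod E (g t) = t * P" for t
      unfolding pos_prod_def prod.remove[OF E(1) e0] P_def g_def i0_def
      by (simp add: mult_ac) 
    have neg: "neg_prod E (g t) = neg_prod E f" for t
      unfolding neg_prod_def g_def i0_def by (intro prod.cong) auto
    have "\<not> p dvd P"
      using nd p E e0 unfolding P_def i0_def by (auto simp: prime_dvd_mult_iff prime_dvd_prod_iff)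
    then have "coprime P p" using p by (metis coprime_commute prime_imp_coprime)
    then obtain w where w: "[P * w = 1] (mod p)" using cong_solve_coprime_int by blast
    define t where "t = (w * neg_prod E f) mod p"
    have "[t * P = (w * neg_prod E f) * P] (mod p)" unfolding t_def by (intro cong_mult) auto
    also have "(w * neg_prod E f) * P = (P * w) * neg_prod E f" by simp
    also have "[(P * w) * neg_prod E f = 1 * neg_prod E f] (mod p)" using w by (intro cong_mult) auto
    finally have bal: "[t * P = neg_prod E f] (mod p)" by simp
    have "\<not> p dvd neg_prod E f"
      using nd p E unfolding neg_prod_def i0_def by (auto simp: prime_dvd_mult_iff prime_dvd_prod_iff)
    then have "\<not> p dvd t * P" using bal cong_dvd_iff by blast
    then have "t \<noteq> 0" by auto
    then have t: "t \<in> {1..<p}" using prime_gt_0_int[OF p] pos_mod_bound[of p] pos_mod_sign[of p]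
      unfolding t_def by (smt (verit) atLeastLessThan_iff)
    have gY: "g t \<in> ?Y" using f t bal pos neg i0 unfolding g_def by (auto simp: PiE_def Pi_def extensional_def)
    have "f = restrict (g t) (?I - {i0})"
      using f unfolding g_def by (auto simp: fun_eq_iff PiE_def extensional_def)
    then show "f \<in> (\<lambda>y. restrict y (?I - {i0})) ` ?Y" using gY by (rule image_eqI[where x = "g t"])
  qed
  then have "card (Pi\<^sub>E (?I - {i0}) (\<lambda>_. {1..<p})) \<le> card ?Y" using finY by (rule surj_card_le[rotated])
  moreover have "card (Pi\<^sub>E (?I - {i0}) (\<lambda>_. {1..<p})) = (nat p - 1) ^ (4 * card E - 1)"
  proof -
    have "nat (p - 1) = nat p - 1" by linarith
    then show ?thesis using finI i0 by (simp add: card_PiE cI)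
  qed
  ultimately show ?thesis by simp
qed

text \<open>The values \<open>\<xi> / (2 (\<xi> - 1))\<close> are pairwise distinct modulo \<open>p\<close>, so \<open>\<xi>\<close> may serve as the name of
  a class of \<open>\<kappa>\<close>.\<close>

lemma class_unique:
  fixes p :: int
  assumes p: "prime p" "2 < p"
    and P: "\<not> p dvd P" and \<xi>: "2 \<le> \<xi>" "\<xi> < p" "2 \<le> \<xi>'" "\<xi>' < p"
    and c: "[P * (2 * (\<xi> - 1)) = \<xi> * N] (mod p)" "[P * (2 * (\<xi>' - 1)) = \<xi>' * N] (mod p)"
  shows "\<xi> = \<xi>'"
proof (rule ccontr)
  assume ne: "\<xi> \<noteq> \<xi>'"
  \<comment> \<open>Cross-multiplying eliminates \<open>N\<close> and leaves
    \<open>P * 2 * (\<xi> - \<xi>')\<close> divisible by \<open>p\<close>.\<close>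
  have "[\<xi>' * (P * (2 * (\<xi> - 1))) = \<xi>' * (\<xi> * N)] (mod p)" using c(1) by (rule cong_scalar_left)
  moreover have "[\<xi> * (P * (2 * (\<xi>' - 1))) = \<xi> * (\<xi>' * N)] (mod p)" using c(2) by (rule cong_scalar_left)
  ultimately have "[\<xi>' * (P * (2 * (\<xi> - 1))) = \<xi> * (P * (2 * (\<xi>' - 1)))] (mod p)"
    by (metis cong_sym cong_trans mult.left_commute)
  then have "p dvd \<xi>' * (P * (2 * (\<xi> - 1))) - \<xi> * (P * (2 * (\<xi>' - 1)))" by (simp add: cong_iff_dvd_diff)
  also have "\<dots> = P * 2 * (\<xi> - \<xi>')" by (simp add: algebra_simps)
  finally have "p dvd 2 \<or> p dvd \<xi> - \<xi>'" using p P by (simp add: prime_dvd_mult_iff)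
  moreover have "\<not> p dvd 2" using p(2) by (simp add: zdvd_not_zless)
  ultimately show False using not_dvd_diff_of_range[OF ne] \<xi> by auto
qed

section \<open>Edge-disjoint families of copies in complete multipartite graphs\<close>

definition partite_family ::
  "'a graph \<Rightarrow> nat \<Rightarrow> 'p set \<Rightarrow> 'j set \<Rightarrow> ('j \<Rightarrow> 'a \<Rightarrow> nat \<times> 'p) \<Rightarrow> bool" where
  "partite_family F s P J \<phi> \<longleftrightarrow>
     (\<forall>j\<in>J. inj_on (\<phi> j) (verts F) \<and> \<phi> j ` verts F \<subseteq> {..<s} \<times> P) \<and>
     (\<forall>j\<in>J. \<forall>u v. {u, v} \<in> edges F \<longrightarrow> fst (\<phi> j u) \<noteq> fst (\<phi> j v)) \<and>
     (\<forall>j\<in>J. \<forall>j'\<in>J. \<forall>e\<in>edges F. \<forall>e'\<in>edges F. \<phi> j ` e = \<phi> j' ` e' \<longrightarrow> j = j')"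

text \<open>The ends of \<open>e'\<close> are named so that they match those of \<open>e\<close> in
  order, which removes the crosswise case from later arguments.\<close>

lemma image_eq_edges:
  assumes "simple_graph F" and "e \<in> edges F" and "e' \<in> edges F" and "f ` e = g ` e'"
    and "\<And>u v. {u, v} \<in> edges F \<Longrightarrow> f u \<noteq> f v"
  obtains u v u' v' where "e = {u, v}" and "e' = {u', v'}" and "f u = g u'" and "f v = g v'"
    and "u \<in> verts F" and "v \<in> verts F" and "u' \<in> verts F" and "v' \<in> verts F"
proof -
  obtain u v where uv: "e = {u, v}" "u \<noteq> v" "u \<in> verts F" "v \<in> verts F" using edge_cases[OF assms(1,2)] by metis
  obtain u' v' where uv': "e' = {u', v'}" "u' \<noteq> v'" "u' \<in> verts F" "v' \<in> verts F" using edge_cases[OF assms(1,3)] by metis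
  have "{f u, f v} = {g u', g v'}" using assms(4) uv uv' by simp
  then consider "f u = g u'" "f v = g v'" | "f u = g v'" "f v = g u'" by (auto simp: doubleton_eq_iff)
  then show thesis
  proof cases
    case 1 then show ?thesis using that uv uv' by blast
  next
    case 2 then show ?thesis using that[of u v v' u'] uv uv' by (auto simp: insert_commute)
  qed
qed

text \<open>Suppose that two copies share an edge. The difference of its ends is
  \<open>(a u - a v) * y\<close>, free of \<open>x\<close>, and its class is named by
  \<open>\<xi>\<close> because \<open>y\<close> is balanced. The name reveals \<open>\<rho>\<close>
  and \<open>\<eta> (\<sigma>, e)\<close>; the two parts met then reveal
  \<open>(\<sigma>, e)\<close>, as \<open>\<eta>\<close> is injective over each pair of parts. The
  parts also fix which end is which, after which \<open>y\<close> follows from the difference and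
  \<open>x\<close> from one end.\<close>

lemma ex_algebraic_family:
  fixes F :: "'a graph" and p :: int
  assumes F: "simple_graph F" "edges F \<noteq> {}" and c: "proper_coloring F s c"
    and p: "prime p" "card (verts F) + 4 \<le> p"
    and S: "finite S" "\<And>\<sigma>. \<sigma> \<in> S \<Longrightarrow> inj_on \<sigma> {..<s} \<and> \<sigma> ` {..<s} \<subseteq> {..<s}"
    and \<eta>: "\<And>B. inj_on \<eta> {(\<sigma>, e) \<in> S \<times> edges F. \<sigma> ` c ` e = B}"
      "\<And>\<sigma> e. \<sigma> \<in> S \<Longrightarrow> e \<in> edges F \<Longrightarrow> \<eta> (\<sigma>, e) < L"
    and R: "int (R * L + 2) \<le> p"
  defines "I \<equiv> edges F \<times> (UNIV :: (bool \<times> bool) set)"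
  defines "Y \<equiv> {y \<in> Pi\<^sub>E I (\<lambda>_. {1..<p}). [pos_prod (edges F) y = neg_prod (edges F) y] (mod p)}"
  defines "P \<equiv> Pi\<^sub>E I (\<lambda>_. {0..<p})"
  shows "\<exists>\<phi>. partite_family F s P (S \<times> {..<R} \<times> P \<times> Y) \<phi>"
proof -
  have fin: "finite (verts F)" "finite (edges F)" using F finite_edges unfolding simple_graph_def by auto
  have c': "c v < s" if "v \<in> verts F" for v using c that unfolding proper_coloring_def by auto
  \<comment> \<open>Class names are written in base \<open>L\<close> with last digit
    \<open>\<eta> (\<sigma>, e)\<close> and round \<open>\<rho>\<close>, so division by
    \<open>L\<close> recovers both. The offset 2 is the least name allowed in
    \<open>class_unique\<close>.\<close>
  define \<xi> where "\<xi> \<sigma> \<rho> e = int (2 + \<rho> * L + \<eta> (\<sigma>, e))" for \<sigma> \<rho> e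
  have \<xi>: "2 \<le> \<xi> \<sigma> \<rho> e \<and> \<xi> \<sigma> \<rho> e < p" if "\<sigma> \<in> S" "\<rho> < R" "e \<in> edges F" for \<sigma> \<rho> e
  proof -
    have "\<rho> * L + \<eta> (\<sigma>, e) < \<rho> * L + L" using \<eta>(2) that by simp
    also have "\<dots> = (\<rho> + 1) * L" by simp
    also have "\<dots> \<le> R * L" using that by (intro mult_right_mono) auto
    finally show ?thesis using R unfolding \<xi>_def by linarith
  qed
  define lab where "lab \<sigma> \<rho> a \<longleftrightarrow>
    (\<forall>u\<in>verts F. \<forall>v\<in>verts F. u \<noteq> v \<longrightarrow> (\<forall>i\<in>edges F \<times> UNIV. \<not> p dvd a u i - a v i)) \<and>
    (\<forall>u v. {u, v} \<in> edges F \<longrightarrow>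
       pos_prod (edges F) (\<lambda>i. a u i - a v i) * (2 * (\<xi> \<sigma> \<rho> {u, v} - 1)) =
       \<xi> \<sigma> \<rho> {u, v} * neg_prod (edges F) (\<lambda>i. a u i - a v i))"
    for \<sigma> \<rho> and a :: "'a \<Rightarrow> 'a set \<times> bool \<times> bool \<Rightarrow> int"
  have "\<exists>a. lab \<sigma> \<rho> a" if "\<sigma> \<in> S" "\<rho> < R" for \<sigma> \<rho>
    unfolding lab_def by (rule ex_labels[OF F(1) p(2)]) (use \<xi> that in blast)
  then obtain a where a: "\<And>\<sigma> \<rho>. \<sigma> \<in> S \<Longrightarrow> \<rho> < R \<Longrightarrow> lab \<sigma> \<rho> (a \<sigma> \<rho>)" by metis
  have a1: "\<not> p dvd a \<sigma> \<rho> u i - a \<sigma> \<rho> v i"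
    if "\<sigma> \<in> S" "\<rho> < R" "u \<in> verts F" "v \<in> verts F" "u \<noteq> v" "i \<in> I" for \<sigma> \<rho> u v i
    using a[OF that(1,2)] that(3-6) unfolding lab_def I_def by blast
  have a2: "pos_prod (edges F) (\<lambda>i. a \<sigma> \<rho> u i - a \<sigma> \<rho> v i) * (2 * (\<xi> \<sigma> \<rho> {u, v} - 1)) =
       \<xi> \<sigma> \<rho> {u, v} * neg_prod (edges F) (\<lambda>i. a \<sigma> \<rho> u i - a \<sigma> \<rho> v i)"
    if "\<sigma> \<in> S" "\<rho> < R" "{u, v} \<in> edges F" for \<sigma> \<rho> u v
    using a[OF that(1,2)] that(3) unfolding lab_def by blast
  \<comment> \<open>\<open>restrict\<close> makes the residue vector extensional on
    \<open>I\<close>, as membership in \<open>P\<close> requires.\<close>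
  define \<phi> where "\<phi> = (\<lambda>(\<sigma>, \<rho>, x, y) v. (\<sigma> (c v), restrict (\<lambda>i. (x i + a \<sigma> \<rho> v i * y i) mod p) I))"
  obtain i0 where i0: "i0 \<in> I" using F(2) unfolding I_def by auto
  have p0: "p > 0" "p > 2" using p by auto
  have Y_range: "1 \<le> y i" "y i < p" if "y \<in> Y" "i \<in> I" for y i
    using that PiE_mem[of y I "\<lambda>_. {1..<p}" i] unfolding Y_def by auto
  have P_range: "0 \<le> x i" "x i < p" if "x \<in> P" "i \<in> I" for x i
    using that PiE_mem[of x I "\<lambda>_. {0..<p}" i] unfolding P_def by auto
  have Y: "\<not> p dvd y i" if "y \<in> Y" "i \<in> I" for y i
    using Y_range[OF that] zdvd_not_zless[of "y i" p] by auto
  have cong_of_eq: "[x i + a \<sigma> \<rho> v i * y i = x' i + a \<sigma>' \<rho>' v' i * y' i] (mod p)"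
    if "snd (\<phi> (\<sigma>, \<rho>, x, y) v) = snd (\<phi> (\<sigma>', \<rho>', x', y') v')" "i \<in> I"
    for \<sigma> \<rho> x y v \<sigma>' \<rho>' x' y' v' i
    unfolding unique_euclidean_semiring_class.cong_def using fun_cong[OF that(1), of i] that(2) unfolding \<phi>_def by simp
  have fst_ne: "fst (\<phi> j u) \<noteq> fst (\<phi> j v)" if j: "j \<in> S \<times> {..<R} \<times> P \<times> Y" and e: "{u, v} \<in> edges F" for j u v
  proof -
    have "u \<in> verts F" "v \<in> verts F" using e F unfolding simple_graph_def by auto
    moreover have "c u \<noteq> c v" using c e unfolding proper_coloring_def by auto
    ultimately show ?thesis using S(2) j c' unfolding \<phi>_def inj_on_def by auto
  qed
  have inj: "inj_on (\<phi> j) (verts F)" if j: "j \<in> S \<times> {..<R} \<times> P \<times> Y" for j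
  proof (rule inj_onI, rule ccontr)
    fix u v assume uv: "u \<in> verts F" "v \<in> verts F" "\<phi> j u = \<phi> j v" "u \<noteq> v"
    obtain \<sigma> \<rho> x y where jj: "j = (\<sigma>, \<rho>, x, y)" "\<sigma> \<in> S" "\<rho> < R" "y \<in> Y" using j by auto
    have "[x i0 + a \<sigma> \<rho> u i0 * y i0 = x i0 + a \<sigma> \<rho> v i0 * y i0] (mod p)"
      using uv(3) i0 unfolding jj by (intro cong_of_eq) auto
    then have "p dvd (a \<sigma> \<rho> u i0 - a \<sigma> \<rho> v i0) * y i0" by (simp add: cong_iff_dvd_diff algebra_simps)
    then show False using a1[OF jj(2,3) uv(1,2,4) i0] Y[OF jj(4) i0] p(1) by (simp add: prime_dvd_mult_iff)
  qed
  have disj: "j = j'"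
    if j: "j \<in> S \<times> {..<R} \<times> P \<times> Y" "j' \<in> S \<times> {..<R} \<times> P \<times> Y"
      and e: "e \<in> edges F" "e' \<in> edges F" "\<phi> j ` e = \<phi> j' ` e'" for j j' e e'
  proof -
    have "\<phi> j u \<noteq> \<phi> j v" if "{u, v} \<in> edges F" for u v using fst_ne[OF j(1) that] by auto
    from image_eq_edges[OF F(1) e this] obtain u v u' v' where
      uv: "e = {u, v}" "e' = {u', v'}" "\<phi> j u = \<phi> j' u'" "\<phi> j v = \<phi> j' v'"
      and V: "u \<in> verts F" "v \<in> verts F" "u' \<in> verts F" "v' \<in> verts F" .
    obtain \<sigma> \<rho> x y where jj: "j = (\<sigma>, \<rho>, x, y)" "\<sigma> \<in> S" "\<rho> < R" "x \<in> P" "y \<in> Y" using j by auto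
    obtain \<sigma>' \<rho>' x' y' where jj': "j' = (\<sigma>', \<rho>', x', y')" "\<sigma>' \<in> S" "\<rho>' < R" "x' \<in> P" "y' \<in> Y" using j by auto
    have ne: "u \<noteq> v" "u' \<noteq> v'" using edge_cases[OF F(1)] e uv by (metis doubleton_eq_iff)+
    define z where "z i = (a \<sigma> \<rho> u i - a \<sigma> \<rho> v i) * y i" for i
    define z' where "z' i = (a \<sigma>' \<rho>' u' i - a \<sigma>' \<rho>' v' i) * y' i" for i
    have cu: "[x i + a \<sigma> \<rho> u i * y i = x' i + a \<sigma>' \<rho>' u' i * y' i] (mod p)"
     and cv: "[x i + a \<sigma> \<rho> v i * y i = x' i + a \<sigma>' \<rho>' v' i * y' i] (mod p)" if "i \<in> I" for i
      using cong_of_eq[OF _ that] uv(3,4) unfolding jj(1) jj'(1) by metis+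
    have zz: "[z i = z' i] (mod p)" if "i \<in> I" for i
      using cong_diff[OF cu[OF that] cv[OF that]] unfolding z_def z'_def by (simp add: algebra_simps)
    have zP: "[pos_prod (edges F) z = pos_prod (edges F) z'] (mod p)"
     and zN: "[neg_prod (edges F) z = neg_prod (edges F) z'] (mod p)"
      using pos_prod_cong[of "edges F" z z' p] zz unfolding I_def by auto
    \<comment> \<open>A balanced vector multiplies both products by the same residue, so the class
      of the label difference is preserved.\<close>
    have same_class: "[pos_prod (edges F) (\<lambda>i. b i * w i) * (2 * (k - 1)) = k * neg_prod (edges F) (\<lambda>i. b i * w i)] (mod p)"
      if "pos_prod (edges F) b * (2 * (k - 1)) = k * neg_prod (edges F) b" "w \<in> Y" for b w k
    proof -
      have "pos_prod (edges F) (\<lambda>i. b i * w i) * (2 * (k - 1)) = (pos_prod (edges F) b * (2 * (k - 1))) * pos_prod (edges F) w"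
        by (simp add: pos_prod_mult mult_ac)
      also have "\<dots> = (k * neg_prod (edges F) b) * pos_prod (edges F) w" using that(1) by simp
      also have "[\<dots> = (k * neg_prod (edges F) b) * neg_prod (edges F) w] (mod p)"
        using that(2) unfolding Y_def by (intro cong_mult) auto
      also have "(k * neg_prod (edges F) b) * neg_prod (edges F) w = k * neg_prod (edges F) (\<lambda>i. b i * w i)"
        by (simp add: neg_prod_mult mult_ac)
      finally show ?thesis .
    qed
    have c1: "[pos_prod (edges F) z * (2 * (\<xi> \<sigma> \<rho> e - 1)) = \<xi> \<sigma> \<rho> e * neg_prod (edges F) z] (mod p)"
      unfolding z_def uv(1) using e(1) unfolding uv(1) by (intro same_class a2 jj)
    have c2: "[pos_prod (edges F) z' * (2 * (\<xi> \<sigma>' \<rho>' e' - 1)) = \<xi> \<sigma>' \<rho>' e' * neg_prod (edges F) z'] (mod p)"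
      unfolding z'_def uv(2) using e(2) unfolding uv(2) by (intro same_class a2 jj')
    have c2': "[pos_prod (edges F) z * (2 * (\<xi> \<sigma>' \<rho>' e' - 1)) = \<xi> \<sigma>' \<rho>' e' * neg_prod (edges F) z] (mod p)"
      using c2 zP zN by (meson cong_mult cong_refl cong_sym cong_trans)
    have nz: "\<not> p dvd pos_prod (edges F) z"
      by (rule prime_not_dvd_pos_prod[OF p(1) fin(2)])
        (use a1[OF jj(2,3) V(1,2) ne(1)] Y[OF jj(5)] p(1) in \<open>simp add: z_def prime_dvd_mult_iff I_def\<close>)
    have "\<xi> \<sigma> \<rho> e = \<xi> \<sigma>' \<rho>' e'"
      using class_unique[OF p(1) p0(2) nz _ _ _ _ c1 c2'] \<xi> jj jj' e by blast
    then have "2 + \<rho> * L + \<eta> (\<sigma>, e) = 2 + \<rho>' * L + \<eta> (\<sigma>', e')"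
      unfolding \<xi>_def by (simp only: of_nat_eq_iff)
    then have eq: "\<rho> * L + \<eta> (\<sigma>, e) = \<rho>' * L + \<eta> (\<sigma>', e')" by simp
    have lt: "\<eta> (\<sigma>, e) < L" "\<eta> (\<sigma>', e') < L" using \<eta>(2) jj jj' e by auto
    have "(\<rho> * L + \<eta> (\<sigma>, e)) div L = \<rho>" "(\<rho>' * L + \<eta> (\<sigma>', e')) div L = \<rho>'" using lt by auto
    then have \<rho>: "\<rho> = \<rho>'" using eq by simp
    then have \<eta>eq: "\<eta> (\<sigma>, e) = \<eta> (\<sigma>', e')" using eq by simp
    have fst: "\<sigma> (c u) = \<sigma>' (c u')" "\<sigma> (c v) = \<sigma>' (c v')"
      using uv(3,4) unfolding jj(1) jj'(1) \<phi>_def by auto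
    then have "\<sigma> ` c ` e = \<sigma>' ` c ` e'" unfolding uv by simp
    then have se: "(\<sigma>, e) = (\<sigma>', e')"
      using inj_onD[OF \<eta>(1)[of "\<sigma> ` c ` e"] \<eta>eq] jj jj' e by auto
    \<comment> \<open>Since the edges are equal and the matched ends have equal colours, the ends
      cannot be matched crosswise.\<close>
    have "c u = c u'" using fst(1) se S(2)[OF jj(2)] c' V unfolding inj_on_def by auto
    moreover have "c u \<noteq> c v" using c e(1) unfolding proper_coloring_def uv by auto
    ultimately have uu: "u' = u" "v' = v" using se uv ne by (auto simp: doubleton_eq_iff)
    have small: "i = k" if "[i = k] (mod p)" "0 \<le> i" "i < p" "0 \<le> k" "k < p" for i k
      using that by (simp add: unique_euclidean_semiring_class.cong_def)
    have yy: "y i = y' i" if i: "i \<in> I" for i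
    proof (rule small)
      have "p dvd (a \<sigma> \<rho> u i - a \<sigma> \<rho> v i) * (y i - y' i)"
        using zz[OF i] se uu unfolding z_def z'_def \<rho> by (simp add: cong_iff_dvd_diff algebra_simps)
      then show "[y i = y' i] (mod p)"
        using a1[OF jj(2,3) V(1,2) ne(1) i] p(1) by (simp add: prime_dvd_mult_iff cong_iff_dvd_diff)
    qed (use Y_range[OF jj(5) i] Y_range[OF jj'(5) i] in auto)
    then have y: "y = y'" using jj(5) jj'(5) PiE_ext[of y I _ y'] unfolding Y_def by blast
    have "x i = x' i" if i: "i \<in> I" for i
    proof (rule small)
      show "[x i = x' i] (mod p)" using cu[OF i] se uu \<rho> y by (simp add: cong_add_rcancel)
    qed (use P_range[OF jj(4) i] P_range[OF jj'(4) i] in auto)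
    then have "x = x'" using jj(4) jj'(4) PiE_ext[of x I _ x'] unfolding P_def by blast
    then show "j = j'" using jj(1) jj'(1) \<rho> y se by simp
  qed
  have range: "\<phi> j ` verts F \<subseteq> {..<s} \<times> P" if j: "j \<in> S \<times> {..<R} \<times> P \<times> Y" for j
    using S(2) j c' p0 unfolding \<phi>_def P_def by (auto simp: image_subset_iff)
  show ?thesis
    unfolding partite_family_def
    by (intro exI[of _ \<phi>] conjI ballI allI impI) (rule inj range fst_ne disj; assumption)+
qed

section \<open>Near-perfect packings\<close>

lemma ex_permutation_mapping_subset:
  assumes "finite A" and "B \<subseteq> A" and "B' \<subseteq> A" and "card B = card B'"
  shows "\<exists>\<tau>. \<tau> permutes A \<and> \<tau> ` B = B'"
proof -
  have fin: "finite B" "finite B'" using assms finite_subset by auto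
  obtain f where f: "bij_betw f B B'" using finite_same_card_bij[OF fin assms(4)] by blast
  have "card (A - B) = card (A - B')" using assms fin by (simp add: card_Diff_subset)
  then obtain g where g: "bij_betw g (A - B) (A - B')"
    using finite_same_card_bij[of "A - B" "A - B'"] assms(1) by blast
  define \<tau> where "\<tau> x = (if x \<in> B then f x else if x \<in> A then g x else x)" for x
  have 1: "bij_betw \<tau> B B'" using f by (rule bij_betw_cong[THEN iffD1, rotated]) (simp add: \<tau>_def)
  have 2: "bij_betw \<tau> (A - B) (A - B')"
    using g by (rule bij_betw_cong[THEN iffD1, rotated]) (simp add: \<tau>_def)
  have "bij_betw \<tau> (B \<union> (A - B)) (B' \<union> (A - B'))" by (rule bij_betw_combine[OF 1 2]) auto
  moreover have "B \<union> (A - B) = A" "B' \<union> (A - B') = A" using assms by auto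
  ultimately have "bij_betw \<tau> A A" by simp
  then have "\<tau> permutes A" using assms(2) by (intro bij_imp_permutes) (auto simp: \<tau>_def)
  with 1 show ?thesis unfolding bij_betw_def by blast
qed

text \<open>Over each pair of parts, \<open>\<eta>\<close> uses every number below \<open>L\<close>
  exactly once. The exact value of \<open>L\<close> lets the same full block of class names be spent
  on all pairs of parts, which makes the packing nearly perfect.\<close>

lemma ex_uniform_index:
  fixes F :: "'a graph"
  assumes F: "simple_graph F" and c: "proper_coloring F s c" and s: "2 \<le> s"
  defines "S \<equiv> {\<sigma>. \<sigma> permutes {..<s}}"
  shows "\<exists>L \<eta>. L * (s choose 2) = card S * card (edges F) \<and>
    (\<forall>B. inj_on \<eta> {(\<sigma>, e) \<in> S \<times> edges F. \<sigma> ` c ` e = B}) \<and>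
    (\<forall>\<sigma>\<in>S. \<forall>e\<in>edges F. \<eta> (\<sigma>, e) < (L::nat))"
proof -
  \<comment> \<open>All fibres have equal size because permuting the parts acts transitively on pairs.\<close>
  define fib where "fib B = {x \<in> S \<times> edges F. fst x ` c ` snd x = B}" for B
  define pairs where "pairs = {B. B \<subseteq> {..<s} \<and> card B = 2}"
  have finS: "finite S" unfolding S_def by (rule finite_permutations) simp
  have finE: "finite (edges F)" using finite_edges[OF F] .
  have finfib: "finite (fib B)" for B unfolding fib_def using finS finE by auto
  have finpairs: "finite pairs" unfolding pairs_def by (rule finite_subset[of _ "Pow {..<s}"]) auto
  have pairs: "fst x ` c ` snd x \<in> pairs" if "x \<in> S \<times> edges F" for x
  proof -
    obtain \<sigma> e where "x = (\<sigma>, e)" by (cases x)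
    with that have x: "x = (\<sigma>, e)" "\<sigma> permutes {..<s}" "e \<in> edges F" unfolding S_def by auto
    obtain u v where uv: "e = {u, v}" "u \<in> verts F" "v \<in> verts F" using edge_cases[OF F x(3)] by metis
    have "c u \<noteq> c v" "c u < s" "c v < s" using c x(3) uv unfolding proper_coloring_def by auto
    moreover from this have "\<sigma> (c u) \<noteq> \<sigma> (c v)" "\<sigma> (c u) < s" "\<sigma> (c v) < s"
      using permutes_in_image[OF x(2)] permutes_inj[OF x(2)] by (auto dest: injD)
    ultimately show ?thesis unfolding x uv pairs_def by auto
  qed
  have le: "card (fib B) \<le> card (fib B')" if B: "B \<in> pairs" "B' \<in> pairs" for B B'
  proof -
    obtain \<tau> where \<tau>: "\<tau> permutes {..<s}" "\<tau> ` B = B'"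
      using ex_permutation_mapping_subset[of "{..<s}" B B'] B unfolding pairs_def by auto
    show ?thesis
    proof (rule card_inj_on_le)
      show "inj_on (\<lambda>(\<sigma>, e). (\<tau> \<circ> \<sigma>, e)) (fib B)"
        using permutes_inj[OF \<tau>(1)] by (auto simp: inj_on_def fun_eq_iff dest: injD)
      show "(\<lambda>(\<sigma>, e). (\<tau> \<circ> \<sigma>, e)) ` fib B \<subseteq> fib B'"
        using \<tau> unfolding fib_def S_def by (auto simp: image_comp[symmetric] intro: permutes_compose)
    qed (rule finfib)
  qed
  define L where "L = card (fib {0, 1})"
  have 01: "{0, 1} \<in> pairs" using s unfolding pairs_def by auto
  have L: "card (fib B) = L" if "B \<in> pairs" for B
    using le[OF that 01] le[OF 01 that] unfolding L_def by simp
  have "card (S \<times> edges F) = (\<Sum>B\<in>pairs. card (fib B))"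
    unfolding fib_def
    using sum.group[of "S \<times> edges F" pairs "\<lambda>x. fst x ` c ` snd x" "\<lambda>_. 1::nat"] finS finE finpairs pairs
    by fastforce
  also have "\<dots> = card pairs * L" using L by simp
  also have "card pairs = s choose 2" unfolding pairs_def by (simp add: n_subsets)
  finally have LS: "L * (s choose 2) = card S * card (edges F)" by (simp add: card_cartesian_product mult.commute)
  have "\<exists>h. inj_on h (fib B) \<and> h ` fib B \<subseteq> {..<L}" if "B \<in> pairs" for B
    using card_le_inj[OF finfib, of "{..<L}" B] L[OF that] by auto
  then obtain h where h: "\<And>B. B \<in> pairs \<Longrightarrow> inj_on (h B) (fib B)" "\<And>B. B \<in> pairs \<Longrightarrow> h B ` fib B \<subseteq> {..<L}"
    by metis
  define \<eta> where "\<eta> x = h (fst x ` c ` snd x) x" for x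
  have "inj_on \<eta> (fib B)" for B
  proof (cases "B \<in> pairs")
    case True
    show ?thesis using h(1)[OF True] by (rule inj_on_cong[THEN iffD1, rotated]) (auto simp: \<eta>_def fib_def)
  next
    case False
    then have "fib B = {}" using pairs unfolding fib_def by auto
    then show ?thesis by simp
  qed
  moreover have "fib B = {(\<sigma>, e) \<in> S \<times> edges F. \<sigma> ` c ` e = B}" for B unfolding fib_def by auto
  moreover have "\<eta> (\<sigma>, e) < L" if "\<sigma> \<in> S" "e \<in> edges F" for \<sigma> e
  proof -
    have "(\<sigma>, e) \<in> fib (\<sigma> ` c ` e)" using that unfolding fib_def by auto
    moreover have "\<sigma> ` c ` e \<in> pairs" using pairs[of "(\<sigma>, e)"] that by auto
    ultimately show ?thesis using h(2) unfolding \<eta>_def by fastforce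
  qed
  ultimately show ?thesis using LS by (intro exI[of _ L] exI[of _ \<eta>]) simp
qed

lemma real_choose_two: "real (n choose 2) = real n * (real n - 1) / 2"
  by (induction n) (auto simp: numeral_2_eq_2 field_simps)

text \<open>The host has \<open>(s choose 2) * p ^ (2 * k)\<close> edges, and the copies cover
  \<open>(s choose 2) * p ^ k * (R * L) * card Y\<close> of them. Here \<open>R * L\<close> is at
  least \<open>p - 2 - L\<close> and \<open>card Y\<close> at least
  \<open>(p - 1) ^ (k - 1)\<close>, so the covered proportion tends to 1 as \<open>p\<close>
  grows.\<close>

lemma ex_dense_partite_family:
  fixes F :: "'a graph" and \<delta> :: real
  assumes F: "simple_graph F" "edges F \<noteq> {}" and c: "proper_coloring F s c" and s: "2 \<le> s" and \<delta>: "\<delta> > 0"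
  shows "\<exists>(P :: ('a set \<times> bool \<times> bool \<Rightarrow> int) set)
           (J :: ((nat \<Rightarrow> nat) \<times> nat \<times> ('a set \<times> bool \<times> bool \<Rightarrow> int) \<times> ('a set \<times> bool \<times> bool \<Rightarrow> int)) set) \<phi>.
           partite_family F s P J \<phi> \<and> finite P \<and> P \<noteq> {} \<and> finite J \<and>
           (1 - \<delta>) * real (s choose 2) * (real (card P))\<^sup>2 \<le> real (card J * card (edges F))"
proof -
  define S where "S = {\<sigma>. \<sigma> permutes {..<s}}"
  define k where "k = 4 * card (edges F)"
  let ?I = "edges F \<times> (UNIV :: (bool \<times> bool) set)"
  have finE: "finite (edges F)" using finite_edges[OF F(1)] .
  have finS: "finite S" unfolding S_def by (rule finite_permutations) simp
  have cE: "card (edges F) > 0" using F finE by (simp add: card_gt_0_iff)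
  then have k: "k \<ge> 1" unfolding k_def by simp
  obtain L \<eta> where L: "L * (s choose 2) = card S * card (edges F)"
    and \<eta>: "\<And>B. inj_on \<eta> {(\<sigma>, e) \<in> S \<times> edges F. \<sigma> ` c ` e = B}"
      "\<And>\<sigma> e. \<sigma> \<in> S \<Longrightarrow> e \<in> edges F \<Longrightarrow> \<eta> (\<sigma>, e) < L"
    using ex_uniform_index[OF F(1) c s] unfolding S_def by blast
  have "id \<in> S" unfolding S_def by (simp add: permutes_id)
  then have "card S > 0" using finS by (auto simp: card_gt_0_iff)
  then have L0: "L > 0" using L cE by (metis mult_is_0 not_gr_zero)
  \<comment> \<open>The function is the lower bound for the covered proportion, with
    \<open>n\<close> in the role of the prime \<open>p\<close>.\<close>
  have "((\<lambda>n. (1 - (real L + 2) * (1 / real n)) * (1 - 1 / real n) ^ (k - 1)) \<longlongrightarrow> (1 - (real L + 2) * 0) * (1 - 0) ^ (k - 1)) sequentially"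
    by (intro tendsto_intros lim_1_over_n)
  then have "\<forall>\<^sub>F n in sequentially. 1 - \<delta> < (1 - (real L + 2) * (1 / real n)) * (1 - 1 / real n) ^ (k - 1)"
    using \<delta> by (intro order_tendstoD) auto
  then obtain n0 where n0: "\<And>n. n \<ge> n0 \<Longrightarrow> 1 - \<delta> < (1 - (real L + 2) * (1 / real n)) * (1 - 1 / real n) ^ (k - 1)"
    unfolding eventually_sequentially by auto
  obtain p where p: "prime p" "p > n0 + L + 2 + card (verts F) + 4" using bigger_prime by blast
  \<comment> \<open>As many rounds of \<open>L\<close> classes as fit into the \<open>p - 2\<close>
    names from 2 to \<open>p - 1\<close>.\<close>
  define R where "R = (p - 2) div L"
  define P where "P = Pi\<^sub>E ?I (\<lambda>_. {0..<int p})"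
  define Y where "Y = {y \<in> Pi\<^sub>E ?I (\<lambda>_. {1..<int p}). [pos_prod (edges F) y = neg_prod (edges F) y] (mod int p)}"
  have "R * L \<le> p - 2" unfolding R_def by simp
  then have "R * L + 2 \<le> p" using p(2) by linarith
  then have Rp: "int (R * L + 2) \<le> int p" by (rule of_nat_mono)
  have pp: "prime (int p)" "int (card (verts F) + 4) \<le> int p" using p by auto
  have Sprop: "inj_on \<sigma> {..<s} \<and> \<sigma> ` {..<s} \<subseteq> {..<s}" if "\<sigma> \<in> S" for \<sigma>
    using that permutes_inj_on[of \<sigma>] permutes_image[of \<sigma>] unfolding S_def by auto
  have "\<exists>\<phi>. partite_family F s P (S \<times> {..<R} \<times> P \<times> Y) \<phi>"
    unfolding P_def Y_def
    by (rule ex_algebraic_family[OF F c pp finS _ \<eta>(1) _ Rp]) (fact Sprop, fact \<eta>(2))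
  then obtain \<phi> where fam: "partite_family F s P (S \<times> {..<R} \<times> P \<times> Y) \<phi>" by (rule exE)
  have finI: "finite ?I" using finE by auto
  have cI: "card ?I = k" unfolding k_def by (simp add: card_cartesian_product flip: UNIV_Times_UNIV)
  have finP: "finite P" unfolding P_def using finI by (intro finite_PiE) auto
  have cP: "card P = p ^ k" unfolding P_def using finI cI by (simp add: card_PiE)
  have cY: "(p - 1) ^ (k - 1) \<le> card Y"
    using card_balanced_ge[OF pp(1) finE F(2)] unfolding Y_def k_def by simp
  have finY: "finite Y" unfolding Y_def
    using finI by (intro finite_subset[OF _ finite_PiE[of ?I "\<lambda>_. {1..<int p}"]]) auto
  have RL: "real p - 2 - L \<le> real (R * L)"
  proof -
    have "p - 2 = R * L + (p - 2) mod L" unfolding R_def by simp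
    moreover have "(p - 2) mod L < L" using L0 by simp
    ultimately have "p \<le> R * L + L + 2" by linarith
    then show ?thesis using of_nat_mono[of p "R * L + L + 2", where 'a = real] by simp
  qed
  have p0: "real p > 0" using p by simp
  have "(1 - \<delta>) * real p ^ k \<le> (1 - (real L + 2) * (1 / real p)) * (1 - 1 / real p) ^ (k - 1) * real p ^ k"
    using n0[of p] p(2) by (intro mult_right_mono) auto
  also have "real p ^ k = real p * real p ^ (k - 1)" using k by (simp flip: power_Suc)
  also have "(1 - (real L + 2) * (1 / real p)) * (1 - 1 / real p) ^ (k - 1) * (real p * real p ^ (k - 1)) =
      ((1 - (real L + 2) * (1 / real p)) * real p) * ((1 - 1 / real p) * real p) ^ (k - 1)"
    by (simp add: power_mult_distrib mult_ac)
  also have "(1 - (real L + 2) * (1 / real p)) * real p = real p - 2 - L" using p0 by (simp add: field_simps)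
  also have "(1 - 1 / real p) * real p = real (p - 1)" using p0 p(2) by (simp add: field_simps of_nat_diff)
  also have "(real p - 2 - L) * real (p - 1) ^ (k - 1) \<le> real (R * L) * real (card Y)"
    using RL p(2) of_nat_mono[OF cY, where 'a = real] by (intro mult_mono) auto
  finally have main: "(1 - \<delta>) * (real p * real p ^ (k - 1)) \<le> real (R * L) * real (card Y)" .
  have pk: "real p * real p ^ (k - 1) = real p ^ k" using k by (simp flip: power_Suc)
  have "card (S \<times> {..<R} \<times> P \<times> Y) * card (edges F) = (card S * card (edges F)) * (R * (p ^ k * card Y))"
    by (simp add: card_cartesian_product cP mult_ac)
  also have "\<dots> = (s choose 2) * p ^ k * (R * L * card Y)" unfolding L[symmetric] by (simp add: mult_ac)
  finally have cJ: "real (card (S \<times> {..<R} \<times> P \<times> Y) * card (edges F)) =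
      (real (s choose 2) * real p ^ k) * (real (R * L) * real (card Y))"
    by (metis of_nat_mult of_nat_power)
  have "(1 - \<delta>) * real (s choose 2) * (real (card P))\<^sup>2 = (real (s choose 2) * real p ^ k) * ((1 - \<delta>) * real p ^ k)"
    unfolding cP by (simp add: power2_eq_square mult_ac)
  also have "\<dots> \<le> (real (s choose 2) * real p ^ k) * (real (R * L) * real (card Y))"
    using main unfolding pk by (intro mult_left_mono) auto
  finally have "(1 - \<delta>) * real (s choose 2) * (real (card P))\<^sup>2 \<le> real (card (S \<times> {..<R} \<times> P \<times> Y) * card (edges F))"
    unfolding cJ .
  moreover have "P \<noteq> {}" using cP p0 finP by (metis card.empty of_nat_0 of_nat_power power_eq_0_iff less_irrefl)
  ultimately show ?thesis using fam finP finS finY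
    by (intro exI[of _ P] exI[of _ "S \<times> {..<R} \<times> P \<times> Y"] exI[of _ \<phi>]) auto
qed

section \<open>Blowing up a family, and packings of all large orders\<close>

definition blowup ::
  "nat \<Rightarrow> ('j \<Rightarrow> 'a \<Rightarrow> nat \<times> 'p) \<Rightarrow> 'j \<times> nat \<times> nat \<Rightarrow> 'a \<Rightarrow> nat \<times> 'p \<times> nat" where
  "blowup m \<phi> = (\<lambda>(j, x, y) v. (fst (\<phi> j v), snd (\<phi> j v), (x + fst (\<phi> j v) * y) mod m))"

text \<open>Each \<open>j\<close> is replaced by the lines with intercept \<open>x\<close> and slope
  \<open>y\<close> modulo \<open>m\<close>, evaluated at the part number. Forgetting the new
  coordinate recovers \<open>j\<close> and the matching of the ends. The values at two different
  parts \<open>a\<close> and \<open>b\<close> then determine \<open>y\<close>, since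
  \<open>a - b\<close> is invertible modulo \<open>m\<close>, and hence \<open>x\<close>. As the
  family grows by \<open>m\<^sup>2\<close> and each part by \<open>m\<close>, the density is
  unchanged.\<close>

lemma partite_family_blowup:
  fixes \<phi> :: "'j \<Rightarrow> 'a \<Rightarrow> nat \<times> 'p"
  assumes F: "simple_graph F" "edges F \<noteq> {}" and fam: "partite_family F s P J \<phi>"
    and m: "m > 0" "\<And>d. 0 < d \<Longrightarrow> d < s \<Longrightarrow> coprime d m"
  shows "partite_family F s (P \<times> {..<m}) (J \<times> {..<m} \<times> {..<m}) (blowup m \<phi>)"
  unfolding partite_family_def
proof (intro conjI ballI allI impI)
  have inj: "inj_on (\<phi> j) (verts F)" and range: "\<phi> j ` verts F \<subseteq> {..<s} \<times> P"
    and fst_ne: "\<And>u v. {u, v} \<in> edges F \<Longrightarrow> fst (\<phi> j u) \<noteq> fst (\<phi> j v)" if "j \<in> J" for j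
    using fam that unfolding partite_family_def by blast+
  define \<pi> where "\<pi> z = (fst z, fst (snd z))" for z :: "nat \<times> 'p \<times> nat"
  have \<pi>: "\<pi> (blowup m \<phi> J' v) = \<phi> (fst J') v" for J' v
    unfolding \<pi>_def blowup_def by (auto simp: case_prod_beta)
  {
    fix J' assume J': "J' \<in> J \<times> {..<m} \<times> {..<m}"
    then have J1: "fst J' \<in> J" by auto
    show "inj_on (blowup m \<phi> J') (verts F)"
      using inj[OF J1] \<pi>[of J'] unfolding inj_on_def by metis
    show "blowup m \<phi> J' ` verts F \<subseteq> {..<s} \<times> P \<times> {..<m}"
      using range[OF J1] m(1) unfolding blowup_def by (auto simp: case_prod_beta image_subset_iff mem_Times_iff)
    show "fst (blowup m \<phi> J' u) \<noteq> fst (blowup m \<phi> J' v)" if "{u, v} \<in> edges F" for u v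
      using fst_ne[OF J1 that] unfolding blowup_def by (auto simp: case_prod_beta)
  }
  fix J1 J2 e e'
  assume J12: "J1 \<in> J \<times> {..<m} \<times> {..<m}" "J2 \<in> J \<times> {..<m} \<times> {..<m}"
    and e: "e \<in> edges F" "e' \<in> edges F" and eq: "blowup m \<phi> J1 ` e = blowup m \<phi> J2 ` e'"
  obtain j x y where J1: "J1 = (j, x, y)" "j \<in> J" "x < m" "y < m" using J12 by auto
  obtain j' x' y' where J2: "J2 = (j', x', y')" "j' \<in> J" "x' < m" "y' < m" using J12 by auto
  have "\<phi> j ` e = \<phi> j' ` e'" using arg_cong[OF eq, of "(`) \<pi>"] unfolding image_image \<pi> J1 J2 by simp
  then have j: "j' = j" using fam J1 J2 e unfolding partite_family_def by blast
  have "blowup m \<phi> J1 u \<noteq> blowup m \<phi> J1 v" if "{u, v} \<in> edges F" for u v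
    using fst_ne[OF J1(2) that] \<pi>[of J1] unfolding J1(1) fst_conv by metis
  from image_eq_edges[OF F(1) e eq this] obtain u v u' v' where
    uv: "e = {u, v}" "blowup m \<phi> J1 u = blowup m \<phi> J2 u'" "blowup m \<phi> J1 v = blowup m \<phi> J2 v'"
    and V: "u \<in> verts F" "v \<in> verts F" "u' \<in> verts F" "v' \<in> verts F" by metis
  have "u' = u" using arg_cong[OF uv(2), of \<pi>] inj_onD[OF inj[OF J1(2)], of u u'] V unfolding \<pi> J1 J2 j by simp
  have "v' = v" using arg_cong[OF uv(3), of \<pi>] inj_onD[OF inj[OF J1(2)], of v v'] V unfolding \<pi> J1 J2 j by simp
  define a b where "a = fst (\<phi> j u)" and "b = fst (\<phi> j v)"
  have ab: "a \<noteq> b" "a < s" "b < s" using fst_ne[OF J1(2)] range[OF J1(2)] V e(1) unfolding uv a_def b_def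
    by (auto simp: image_subset_iff mem_Times_iff)
  have "(x + a * y) mod m = (x' + a * y') mod m"
    using uv(2) \<open>u' = u\<close> unfolding J1 J2 j blowup_def a_def by simp
  then have ca: "[int x + int a * int y = int x' + int a * int y'] (mod int m)"
    unfolding unique_euclidean_semiring_class.cong_def by (metis of_nat_add of_nat_mod of_nat_mult)
  have "(x + b * y) mod m = (x' + b * y') mod m"
    using uv(3) \<open>v' = v\<close> unfolding J1 J2 j blowup_def b_def by simp
  then have cb: "[int x + int b * int y = int x' + int b * int y'] (mod int m)"
    unfolding unique_euclidean_semiring_class.cong_def by (metis of_nat_add of_nat_mod of_nat_mult)
  have "[(int a - int b) * int y = (int a - int b) * int y'] (mod int m)"
    using cong_diff[OF ca cb] by (simp add: algebra_simps)
  \<comment> \<open>The hypothesis speaks of positive differences of part numbers, so the two signs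
    are treated apart.\<close>
  moreover have "coprime (int a - int b) (int m)"
  proof (cases "a < b")
    case True
    then have "coprime (int (b - a)) (int m)" using m(2)[of "b - a"] ab unfolding coprime_int_iff by simp
    moreover have "int a - int b = - int (b - a)" using True by simp
    ultimately show ?thesis by (simp only: coprime_minus_left_iff)
  next
    case False
    then have "coprime (int (a - b)) (int m)" using m(2)[of "a - b"] ab unfolding coprime_int_iff by simp
    then show ?thesis using False by (simp add: of_nat_diff)
  qed
  ultimately have "[int y = int y'] (mod int m)" by (simp add: cong_mult_lcancel)
  then have y: "y' = y" using J1 J2 by (simp add: cong_int_iff unique_euclidean_semiring_class.cong_def)
  then have "[int x = int x'] (mod int m)" using ca by (simp add: cong_add_rcancel)
  then have "x' = x" using J1 J2 by (simp add: cong_int_iff unique_euclidean_semiring_class.cong_def)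
  then show "J1 = J2" using J1 J2 j y by simp
qed

text \<open>The points are numbered injectively by \<open>h\<close>, and \<open>q\<close> reads the
  part back from the number. It is returned as a proper coloring of the union with \<open>s\<close>
  colours, from which the absence of \<open>G\<close> follows.\<close>

lemma F_packing_of_partite_family:
  assumes F: "simple_graph F" and fam: "partite_family F s P J \<phi>"
    and fin: "finite P" "finite J" and n: "s * card P \<le> n"
  shows "\<exists>Fs q. F_packing F n (card J) Fs \<and>
    (\<forall>v\<in>verts (graph_union (card J) Fs). q v < s) \<and>
    (\<forall>u v. {u, v} \<in> edges (graph_union (card J) Fs) \<longrightarrow> q u \<noteq> q v)"
proof -
  have inj: "inj_on (\<phi> j) (verts F)" and range: "\<phi> j ` verts F \<subseteq> {..<s} \<times> P"
    and fst_ne: "\<And>u v. {u, v} \<in> edges F \<Longrightarrow> fst (\<phi> j u) \<noteq> fst (\<phi> j v)" if "j \<in> J" for j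
    using fam that unfolding partite_family_def by blast+
  have uniq: "j = j'" if "j \<in> J" "j' \<in> J" "e \<in> edges F" "e' \<in> edges F" "\<phi> j ` e = \<phi> j' ` e'" for j j' e e'
    using fam that unfolding partite_family_def by blast
  have "card ({..<s} \<times> P) \<le> card {..<n}" using n by (simp add: card_cartesian_product)
  then obtain h where h: "inj_on h ({..<s} \<times> P)" "h ` ({..<s} \<times> P) \<subseteq> {..<n}"
    using card_le_inj[of "{..<s} \<times> P" "{..<n}"] fin by auto
  obtain t where t: "bij_betw t {..<card J} J"
    using ex_bij_betw_nat_finite[OF fin(2)] unfolding atLeast0LessThan by blast
  have tJ: "t i \<in> J" if "i < card J" for i using t that unfolding bij_betw_def by auto
  define Fs where "Fs i = image_graph (h \<circ> \<phi> (t i)) F" for i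
  define q where "q = fst \<circ> the_inv_into ({..<s} \<times> P) h"
  have qh: "q (h z) = fst z" if "z \<in> {..<s} \<times> P" for z
    using the_inv_into_f_f[OF h(1) that] unfolding q_def by simp
  have inj': "inj_on (h \<circ> \<phi> (t i)) (verts F)" if "i < card J" for i
    using inj[OF tJ[OF that]] range[OF tJ[OF that]] h(1) by (intro comp_inj_on) (auto intro: inj_on_subset)
  have edge_sub: "e \<subseteq> verts F" if "e \<in> edges F" for e using F that unfolding simple_graph_def by auto
  have "F_packing F n (card J) Fs"
    unfolding F_packing_def
  proof (intro conjI allI impI)
    fix i assume i: "i < card J"
    have simple: "simple_graph (Fs i)" unfolding Fs_def by (rule simple_image_graph[OF F inj'[OF i]])
    moreover have vs: "verts (Fs i) \<subseteq> {..<n}"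
      using range[OF tJ[OF i]] h(2) unfolding Fs_def by fastforce
    ultimately show "subgraph (Fs i) (complete_graph n)"
      unfolding subgraph_def complete_graph_def simple_graph_def by auto
    show "isomorphic (Fs i) F" unfolding Fs_def by (rule isomorphic_image_graph[OF F inj'[OF i]])
  next
    fix i i' assume i: "i < card J" "i' < card J" "i \<noteq> i'"
    show "edges (Fs i) \<inter> edges (Fs i') = {}"
    proof (rule ccontr)
      assume "edges (Fs i) \<inter> edges (Fs i') \<noteq> {}"
      then obtain e e' where e: "e \<in> edges F" "e' \<in> edges F" "h ` \<phi> (t i) ` e = h ` \<phi> (t i') ` e'"
        unfolding Fs_def by (auto simp: image_comp)
      have "\<phi> (t i) ` e \<subseteq> {..<s} \<times> P" "\<phi> (t i') ` e' \<subseteq> {..<s} \<times> P"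
        using range[OF tJ[OF i(1)]] range[OF tJ[OF i(2)]] edge_sub[OF e(1)] edge_sub[OF e(2)] by blast+
      then have "\<phi> (t i) ` e = \<phi> (t i') ` e'" 
        using e(3) inj_on_image_eq_iff[OF h(1), of "\<phi> (t i) ` e" "\<phi> (t i') ` e'"] by simp
      then have "t i = t i'" using uniq[OF tJ[OF i(1)] tJ[OF i(2)] e(1,2)] by simp
      then show False using t i unfolding bij_betw_def inj_on_def by auto
    qed
  qed
  moreover have "q v < s" if v: "v \<in> verts (graph_union (card J) Fs)" for v
  proof -
    obtain i w where i: "i < card J" "w \<in> verts F" "v = h (\<phi> (t i) w)"
      using v unfolding graph_union_def Fs_def by auto
    have "\<phi> (t i) w \<in> {..<s} \<times> P" using range[OF tJ[OF i(1)]] i(2) by auto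
    then show ?thesis using qh i(3) by auto
  qed
  moreover have "q u \<noteq> q v" if uv: "{u, v} \<in> edges (graph_union (card J) Fs)" for u v
  proof -
    obtain i e where i: "i < card J" "e \<in> edges F" "{u, v} = (h \<circ> \<phi> (t i)) ` e"
      using uv unfolding graph_union_def Fs_def by auto
    obtain a b where ab: "e = {a, b}" "a \<in> verts F" "b \<in> verts F" using edge_cases[OF F i(2)] by metis
    have "\<phi> (t i) a \<in> {..<s} \<times> P" "\<phi> (t i) b \<in> {..<s} \<times> P" using range[OF tJ[OF i(1)]] ab by auto
    then have "q (h (\<phi> (t i) a)) \<noteq> q (h (\<phi> (t i) b))"
      using qh fst_ne[OF tJ[OF i(1)]] i(2) unfolding ab by auto
    then show ?thesis using i(3) unfolding ab by (auto simp: doubleton_eq_iff)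
  qed
  ultimately show ?thesis by blast
qed

text \<open>A single family with \<open>h\<close> positions per part is fixed in terms of
  \<open>\<epsilon>\<close> alone. Its blow-ups have \<open>s * (h * m)\<close> points, and a
  suitable \<open>m\<close> brings this within the constant \<open>2 * D\<close> of
  \<open>n\<close>, which costs only a vanishing proportion of the edges.\<close>

lemma ex_dense_packing:
  fixes F :: "'a graph" and \<epsilon> :: real
  assumes F: "simple_graph F" "edges F \<noteq> {}" and c: "proper_coloring F s c" and s: "2 \<le> s" and \<epsilon>: "\<epsilon> > 0"
  shows "\<forall>\<^sub>F n in sequentially. \<exists>k Fs q. F_packing F n k Fs \<and>
    (\<forall>v\<in>verts (graph_union k Fs). q v < s) \<and>
    (\<forall>u v. {u, v} \<in> edges (graph_union k Fs) \<longrightarrow> q u \<noteq> q v) \<and>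
    ((1 - 1 / real s) / 2 - \<epsilon>) * (real n)\<^sup>2 \<le> real (k * num_edges F)"
proof -
  \<comment> \<open>The cap at 1 keeps \<open>1 - \<delta>\<close> nonnegative as a factor in later
    inequalities.\<close>
  define \<delta> where "\<delta> = min \<epsilon> 1"
  have \<delta>: "\<delta> > 0" "\<delta> \<le> 1" "\<delta> \<le> \<epsilon>" using \<epsilon> unfolding \<delta>_def by auto
  obtain P :: "('a set \<times> bool \<times> bool \<Rightarrow> int) set" and
    J :: "((nat \<Rightarrow> nat) \<times> nat \<times> ('a set \<times> bool \<times> bool \<Rightarrow> int) \<times> ('a set \<times> bool \<times> bool \<Rightarrow> int)) set" and \<phi>
    where fam: "partite_family F s P J \<phi>" and fin: "finite P" "P \<noteq> {}" "finite J"
      and dense: "(1 - \<delta>) * real (s choose 2) * (real (card P))\<^sup>2 \<le> real (card J * card (edges F))"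
    using ex_dense_partite_family[OF F c s \<delta>(1)] by metis
  define h where "h = card P"
  have h: "h > 0" using fin unfolding h_def by (simp add: card_gt_0_iff)
  define D where "D = s * h * fact s"
  have D: "D > 0" using h s unfolding D_def by simp
  define C where "C = (1 - 1 / real s) / 2"
  have C: "0 < C" "C \<le> 1" using s unfolding C_def by (auto simp: field_simps)
  have "((\<lambda>n. (1 - \<delta>) * C * (1 - 2 * real D * (1 / real n))\<^sup>2) \<longlongrightarrow> (1 - \<delta>) * C * (1 - 2 * real D * 0)\<^sup>2) sequentially"
    by (intro tendsto_intros lim_1_over_n)
  \<comment> \<open>The limit is \<open>C - \<delta> * C\<close>, which exceeds
    \<open>C - \<epsilon>\<close> unless \<open>\<delta> * C = \<epsilon>\<close>; that case is then
    excluded by \<open>C < 1\<close>.\<close>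
  moreover have "C - \<epsilon> < (1 - \<delta>) * C * (1 - 2 * real D * 0)\<^sup>2 \<or> \<delta> * C = \<epsilon>"
  proof -
    have "\<delta> * C \<le> \<epsilon> * 1" using \<delta> C by (intro mult_mono) auto
    then show ?thesis by (auto simp: algebra_simps)
  qed
  moreover have "\<delta> * C \<noteq> \<epsilon>"
  proof -
    have "C < 1" using s unfolding C_def by (auto simp: field_simps)
    then have "\<delta> * C < \<delta> * 1" using \<delta> by (intro mult_strict_left_mono) auto
    with \<delta>(3) show ?thesis by simp
  qed
  ultimately have "\<forall>\<^sub>F n in sequentially. C - \<epsilon> < (1 - \<delta>) * C * (1 - 2 * real D * (1 / real n))\<^sup>2"
    by (intro order_tendstoD) auto
  moreover have "\<forall>\<^sub>F n in sequentially. n \<ge> 2 * D" by (rule eventually_ge_at_top)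
  ultimately show ?thesis
  proof eventually_elim
    case (elim n)
    have n0: "real n > 0" using elim(2) D by simp
    \<comment> \<open>Subtracting 1 leaves room for the summand 1 of \<open>m\<close>, which costs
      \<open>s * h \<le> D\<close> further points. That summand makes \<open>m\<close> congruent to
      1 modulo \<open>fact s\<close>, hence coprime to every positive \<open>d < s\<close>.\<close>
    define t where "t = n div D - 1"
    define m where "m = fact s * t + 1"
    have ndiv: "n div D \<ge> 2" using elim(2) D by (simp add: less_eq_div_iff_mult_less_eq mult.commute)
    have "s * (h * m) = D * t + s * h" unfolding m_def D_def by (simp add: algebra_simps)
    also have "\<dots> \<le> D * t + D" unfolding D_def by (simp add: fact_ge_1)
    also have "\<dots> = D * (n div D)" using ndiv unfolding t_def by (simp add: algebra_simps)
    also have "\<dots> \<le> n" by simp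
    finally have shm: "s * (h * m) \<le> n" .
    have "n < D * (n div D) + D" using D by (metis mult_div_mod_eq mod_less_divisor add_less_cancel_left)
    also have "D * (n div D) = D * t + D" using ndiv unfolding t_def by (simp add: algebra_simps)
    finally have "n \<le> D * t + 2 * D" by simp
    moreover have "D * t \<le> s * (h * m)" unfolding m_def D_def by (simp add: algebra_simps)
    ultimately have "n \<le> s * (h * m) + 2 * D" by linarith
    then have lower: "real n - 2 * real D \<le> real s * (real h * real m)"
      using of_nat_mono[of n "s * (h * m) + 2 * D", where 'a = real] by simp
    have cop: "coprime d m" if "0 < d" "d < s" for d
    proof -
      have "d dvd fact s" using that by (intro dvd_fact) auto
      then have "d dvd fact s * t" by simp
      then show ?thesis unfolding m_def
        by (metis coprime_Suc_right_nat coprime_divisors dvd_refl Suc_eq_plus1)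
    qed
    have "m > 0" unfolding m_def by simp
    have fam': "partite_family F s (P \<times> {..<m}) (J \<times> {..<m} \<times> {..<m}) (blowup m \<phi>)"
      by (rule partite_family_blowup[OF F fam \<open>m > 0\<close> cop])
    let ?k = "card (J \<times> {..<m} \<times> {..<m})"
    have size: "s * card (P \<times> {..<m}) \<le> n" using shm by (simp add: card_cartesian_product h_def)
    obtain Fs q where pack: "F_packing F n ?k Fs" "\<forall>v\<in>verts (graph_union ?k Fs). q v < s"
      "\<forall>u v. {u, v} \<in> edges (graph_union ?k Fs) \<longrightarrow> q u \<noteq> q v"
      using F_packing_of_partite_family[OF F(1) fam' _ _ size] fin by auto
    have "(C - \<epsilon>) * (real n)\<^sup>2 \<le> ((1 - \<delta>) * C * (1 - 2 * real D * (1 / real n))\<^sup>2) * (real n)\<^sup>2"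
      using elim(1) by (intro mult_right_mono) auto
    also have "\<dots> = (1 - \<delta>) * C * ((1 - 2 * real D * (1 / real n)) * real n)\<^sup>2"
      by (simp add: power_mult_distrib)
    also have "(1 - 2 * real D * (1 / real n)) * real n = real n - 2 * real D" using n0 by (simp add: field_simps)
    also have "(1 - \<delta>) * C * (real n - 2 * real D)\<^sup>2 \<le> (1 - \<delta>) * C * (real s * (real h * real m))\<^sup>2"
      using lower elim(2) \<delta> C by (intro mult_left_mono power_mono) auto
    also have "\<dots> = ((1 - \<delta>) * (C * (real s)\<^sup>2) * (real h)\<^sup>2) * (real m)\<^sup>2" by (simp add: power_mult_distrib)
    also have "C * (real s)\<^sup>2 = real (s choose 2)"
      using s unfolding C_def real_choose_two by (simp add: field_simps power2_eq_square)
    also have "((1 - \<delta>) * real (s choose 2) * (real h)\<^sup>2) * (real m)\<^sup>2 \<le> real (card J * card (edges F)) * (real m)\<^sup>2"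
      using dense unfolding h_def by (intro mult_right_mono) auto
    also have "\<dots> = real (?k * num_edges F)"
      unfolding num_edges_def by (simp add: card_cartesian_product power2_eq_square)
    finally have "(C - \<epsilon>) * (real n)\<^sup>2 \<le> real (?k * num_edges F)" .
    with pack show ?case unfolding C_def by blast
  qed
qed

section \<open>Rainbow and ordinary copies forced by large parts\<close>

lemma card_edges_packing:
  assumes F: "simple_graph F" and pack: "F_packing F n k Fs"
  shows "card (edges (graph_union k Fs)) = k * num_edges F"
    and "\<And>e. e \<in> edges (graph_union k Fs) \<Longrightarrow> e \<subseteq> {..<n} \<and> card e = 2"
proof -
  have sub: "subgraph (Fs i) (complete_graph n)" and iso: "isomorphic (Fs i) F" if "i < k" for i
    using pack that unfolding F_packing_def by auto
  have simple: "simple_graph (Fs i)" if "i < k" for i using sub[OF that] unfolding subgraph_def by simp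
  have "card (edges (graph_union k Fs)) = (\<Sum>i<k. card (edges (Fs i)))"
    unfolding graph_union_def
    using pack simple finite_edges unfolding F_packing_def by (simp, intro card_UN_disjoint) auto
  also have "\<dots> = k * num_edges F"
    using isomorphic_card(2)[OF iso simple F] unfolding num_edges_def by simp
  finally show "card (edges (graph_union k Fs)) = k * num_edges F" .
  show "e \<subseteq> {..<n} \<and> card e = 2" if "e \<in> edges (graph_union k Fs)" for e
    using that sub unfolding graph_union_def subgraph_def complete_graph_def by auto
qed

text \<open>\<open>W x\<close> is the vertex set of the one packed copy that contains
  \<open>x\<close>, and is empty if there is none. If a packed copy contained two edges of the
  embedded \<open>G\<close>, an end of one that is off the other would be mapped into a forbidden
  place.\<close>

lemma ex_rainbow_copy:
  fixes F :: "'a graph" and G :: "'b graph"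
  assumes F: "simple_graph F" and G: "simple_graph G" "no_isolated_vertices G"
    and pack: "F_packing F n k Fs"
    and part: "has_partite V (edges (graph_union k Fs)) (chromatic_number G) T"
    and T: "card (verts G) * (card (verts G) + num_edges G * card (verts F)) < T"
  shows "\<exists>G'. rainbow_copy G k Fs G'"
proof -
  have sub: "subgraph (Fs i) (complete_graph n)" and iso: "isomorphic (Fs i) F" if "i < k" for i
    using pack that unfolding F_packing_def by auto
  have simple: "simple_graph (Fs i)" if "i < k" for i using sub[OF that] unfolding subgraph_def by simp
  have disj: "i = j" if "i < k" "j < k" "x \<in> edges (Fs i)" "x \<in> edges (Fs j)" for i j x
    using pack that unfolding F_packing_def by blast
  define W where "W x = (\<Union>i\<in>{i. i < k \<and> x \<in> edges (Fs i)}. verts (Fs i))" for x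
  have W: "finite (W x) \<and> card (W x) \<le> card (verts F)" for x
  proof (cases "\<exists>i<k. x \<in> edges (Fs i)")
    case True
    then obtain i where i: "i < k" "x \<in> edges (Fs i)" by auto
    then have "{i. i < k \<and> x \<in> edges (Fs i)} = {i}" using disj by blast
    then have "W x = verts (Fs i)" unfolding W_def by simp
    then show ?thesis using isomorphic_card(1)[OF iso simple F] simple i(1) unfolding simple_graph_def by simp
  next
    case False
    then have "W x = {}" unfolding W_def by auto
    then show ?thesis by simp
  qed
  obtain c where c: "proper_coloring G (chromatic_number G) c" using proper_coloring_chromatic_number[OF G(1)] by auto
  obtain f where f: "inj_on f (verts G)" and "f ` verts G \<subseteq> V" and fE: "\<And>e. e \<in> edges G \<Longrightarrow> f ` e \<in> edges (graph_union k Fs)"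
    and fW: "\<And>e v. e \<in> edges G \<Longrightarrow> v \<in> verts G - e \<Longrightarrow> f v \<notin> W (f ` e)"
    by (rule embed_in_partite[where W = W, OF G(1) c part W T]) (rule that; assumption?; blast)
  have edge_in: "x \<subseteq> verts (Fs i)" if "i < k" "x \<in> edges (Fs i)" for i x
    using simple[OF that(1)] that(2) unfolding simple_graph_def by auto
  \<comment> \<open>Each vertex of \<open>G\<close> lies on an edge, so its image lies in a packed
    copy; membership in \<open>V\<close> would not give this.\<close>
  have "f ` verts G \<subseteq> verts (graph_union k Fs)"
  proof
    fix y assume "y \<in> f ` verts G"
    then obtain v e where v: "y = f v" "e \<in> edges G" "v \<in> e" using G(2) unfolding no_isolated_vertices_def by blast
    then have "f ` e \<in> edges (graph_union k Fs)" using fE by auto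
    then obtain i where "i < k" "f ` e \<in> edges (Fs i)" unfolding graph_union_def by auto
    then have "y \<in> verts (Fs i)" using edge_in v by blast
    then show "y \<in> verts (graph_union k Fs)" using \<open>i < k\<close> unfolding graph_union_def by auto
  qed
  then have "subgraph (image_graph f G) (graph_union k Fs)"
    unfolding subgraph_def using simple_image_graph[OF G(1) f] fE by auto
  moreover have "card (edges (image_graph f G) \<inter> edges (Fs i)) \<le> 1" if i: "i < k" for i
  proof (rule ccontr)
    assume "\<not> card (edges (image_graph f G) \<inter> edges (Fs i)) \<le> 1"
    then obtain x y where xy: "x \<in> edges (image_graph f G) \<inter> edges (Fs i)" "y \<in> edges (image_graph f G) \<inter> edges (Fs i)" "x \<noteq> y"
      by (metis card_le_Suc0_iff_eq One_nat_def card.infinite zero_le)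
    then obtain e e' where e: "e \<in> edges G" "e' \<in> edges G" "x = f ` e" "y = f ` e'" "e \<noteq> e'" by auto
    have "card e = 2" "card e' = 2" "finite e'" "e' \<subseteq> verts G" "finite e"
      using G(1) e finite_subset unfolding simple_graph_def by blast+
    then have "\<not> e' \<subseteq> e" using e(5) card_subset_eq[of e e'] by auto
    then obtain v where v: "v \<in> e'" "v \<notin> e" by auto
    then have "f v \<in> verts (Fs i)" using edge_in[OF i, of y] xy(2) e(4) by auto
    moreover have "f ` e \<in> edges (Fs i)" using xy(1) e(3) by auto
    ultimately have "f v \<in> W (f ` e)" using i unfolding W_def by auto
    then show False using fW[OF e(1)] v \<open>e' \<subseteq> verts G\<close> by auto
  qed
  ultimately show ?thesis unfolding rainbow_copy_def using isomorphic_image_graph[OF G(1) f] by blast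
qed

lemma ex_copy:
  fixes G :: "'b graph" and H :: "'a graph"
  assumes G: "simple_graph G"
    and part: "has_partite (verts H) (edges H) (chromatic_number G) T"
    and T: "card (verts G) * card (verts G) < T"
  shows "\<exists>G'. subgraph G' H \<and> isomorphic G' G"
proof -
  obtain c where c: "proper_coloring G (chromatic_number G) c" using proper_coloring_chromatic_number[OF G] by auto
  obtain f where "inj_on f (verts G)" "f ` verts G \<subseteq> verts H" "\<And>e. e \<in> edges G \<Longrightarrow> f ` e \<in> edges H"
    using embed_in_partite[OF G c part, of "\<lambda>_. {}" 0] T by auto
  then have "subgraph (image_graph f G) H \<and> isomorphic (image_graph f G) G"
    using simple_image_graph[OF G] isomorphic_image_graph[OF G] unfolding subgraph_def by auto
  then show ?thesis by blast
qed

section \<open>Asymptotics\<close>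

lemma asymp_equiv_quadratic:
  fixes a :: "nat \<Rightarrow> real"
  assumes C: "C > 0"
    and upper: "\<And>\<epsilon>. \<epsilon> > 0 \<Longrightarrow> \<forall>\<^sub>F n in sequentially. a n \<le> (C + \<epsilon>) * (real n)\<^sup>2"
    and lower: "\<And>\<epsilon>. \<epsilon> > 0 \<Longrightarrow> \<forall>\<^sub>F n in sequentially. (C - \<epsilon>) * (real n)\<^sup>2 \<le> a n"
  shows "a \<sim>[sequentially] (\<lambda>n. C * (real n)\<^sup>2)"
proof (rule asymp_equivI', rule tendstoI)
  fix \<epsilon> :: real assume \<epsilon>: "\<epsilon> > 0"
  \<comment> \<open>This is the relative error \<open>\<epsilon> / 2\<close>; halving makes the
    final inequality strict.\<close>
  then have e: "C * \<epsilon> / 2 > 0" using C by simp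
  show "\<forall>\<^sub>F n in sequentially. dist (a n / (C * (real n)\<^sup>2)) 1 < \<epsilon>"
    using upper[OF e] lower[OF e] eventually_gt_at_top[of 0]
  proof eventually_elim
    case (elim n)
    define N where "N = C * (real n)\<^sup>2"
    have N: "N > 0" using elim(3) C unfolding N_def by simp
    have "a n \<le> (1 + \<epsilon> / 2) * N" "(1 - \<epsilon> / 2) * N \<le> a n"
      using elim(1,2) unfolding N_def by (simp_all add: algebra_simps)
    then have "a n / N \<le> 1 + \<epsilon> / 2" "1 - \<epsilon> / 2 \<le> a n / N" using N by (simp_all add: field_simps)
    then show ?case using \<epsilon> unfolding N_def dist_real_def by linarith
  qed
qed

text \<open>Both claims are properties of \<open>Max\<close>. The set is finite by the crude bound
  \<open>2 ^ n\<close>, and the edgeless graph on \<open>n\<close> vertices shows that it is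
  nonempty, since \<open>G\<close> has an edge.\<close>

lemma turan_number_bounds:
  fixes G :: "'b graph"
  assumes G: "simple_graph G" "edges G \<noteq> {}"
  shows "\<exists>H :: nat graph. turan_number n G = num_edges H \<and> simple_graph H \<and> card (verts H) = n \<and>
            \<not> (\<exists>G'. subgraph G' H \<and> isomorphic G' G)" (is ?ex)
    and "\<And>H :: nat graph. simple_graph H \<Longrightarrow> card (verts H) = n \<Longrightarrow>
            \<not> (\<exists>G'. subgraph G' H \<and> isomorphic G' G) \<Longrightarrow> num_edges H \<le> turan_number n G"
proof -
  let ?A = "{num_edges H | H :: nat graph. simple_graph H \<and> card (verts H) = n \<and>
            \<not> (\<exists>G'. subgraph G' H \<and> isomorphic G' G)}"
  have "num_edges H \<le> 2 ^ n" if "simple_graph H" "card (verts H) = n" for H :: "nat graph"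
  proof -
    have "edges H \<subseteq> Pow (verts H)" "finite (verts H)" using that unfolding simple_graph_def by auto
    then have "card (edges H) \<le> card (Pow (verts H))" by (intro card_mono) auto
    then show ?thesis using that \<open>finite (verts H)\<close> unfolding num_edges_def by (simp add: card_Pow)
  qed
  then have "?A \<subseteq> {..2 ^ n}" by auto
  then have fin: "finite ?A" by (rule finite_subset) simp
  have "\<not> (subgraph G' (Graph {..<n} {}) \<and> isomorphic G' G)" for G' :: "nat graph"
  proof
    assume *: "subgraph G' (Graph {..<n} {}) \<and> isomorphic G' G"
    then have "num_edges G' = num_edges G" using isomorphic_card(2) G unfolding subgraph_def by blast
    moreover have "edges G' = {}" using * unfolding subgraph_def by auto
    ultimately show False using G finite_edges[OF G(1)] unfolding num_edges_def by auto
  qed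
  moreover have "simple_graph (Graph {..<n} {} :: nat graph)" unfolding simple_graph_def by simp
  ultimately have "num_edges (Graph {..<n} {} :: nat graph) \<in> ?A" by (intro CollectI exI[of _ "Graph {..<n} {}"]) auto
  then have "Max ?A \<in> ?A" using fin by (intro Max_in) auto
  then show ?ex unfolding turan_number_def by blast
  show "num_edges H \<le> turan_number n G" if "simple_graph H" "card (verts H) = n"
    "\<not> (\<exists>G'. subgraph G' H \<and> isomorphic G' G)" for H :: "nat graph"
    unfolding turan_number_def using fin that by (intro Max_ge) auto
qed

text \<open>Again \<open>Max\<close> is well behaved: edge-disjoint copies with at least one edge
  each number at most \<open>2 ^ n\<close>, and the empty packing is admissible because its union
  has no edges.\<close>

lemma F_turan_number_bounds:
  fixes F :: "'a graph" and G :: "'b graph"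
  assumes F: "simple_graph F" "edges F \<noteq> {}" and G: "simple_graph G" "edges G \<noteq> {}"
  shows "\<exists>Fs. F_packing F n (F_turan_number F n G) Fs \<and> \<not> (\<exists>G'. rainbow_copy G (F_turan_number F n G) Fs G')" (is ?ex)
    and "\<And>k Fs. F_packing F n k Fs \<Longrightarrow> \<not> (\<exists>G'. rainbow_copy G k Fs G') \<Longrightarrow> k \<le> F_turan_number F n G"
proof -
  let ?A = "{k. \<exists>Fs. F_packing F n k Fs \<and> \<not> (\<exists>G'. rainbow_copy G k Fs G')}"
  have eF: "num_edges F \<ge> 1" using F finite_edges[OF F(1)] unfolding num_edges_def by (simp add: Suc_le_eq card_gt_0_iff)
  have "k \<le> 2 ^ n" if "F_packing F n k Fs" for k Fs
  proof -
    have "k * 1 \<le> k * num_edges F" using eF by (rule mult_le_mono2)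
    also have "\<dots> = card (edges (graph_union k Fs))" using card_edges_packing(1)[OF F(1) that] by simp
    also have "\<dots> \<le> card (Pow {..<n})" using card_edges_packing(2)[OF F(1) that] by (intro card_mono) auto
    finally show ?thesis by (simp add: card_Pow)
  qed
  then have "?A \<subseteq> {..2 ^ n}" by auto
  then have fin: "finite ?A" by (rule finite_subset) simp
  have "\<not> rainbow_copy G 0 Fs G'" for Fs and G' :: "nat graph"
  proof
    assume "rainbow_copy G 0 Fs G'"
    then have *: "subgraph G' (graph_union 0 Fs)" "isomorphic G' G" unfolding rainbow_copy_def by auto
    then have "num_edges G' = num_edges G" using isomorphic_card(2) G unfolding subgraph_def by blast
    moreover have "edges G' = {}" using * unfolding subgraph_def graph_union_def by auto
    ultimately show False using G finite_edges[OF G(1)] unfolding num_edges_def by auto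
  qed
  moreover have "F_packing F n 0 (\<lambda>_. undefined)" unfolding F_packing_def by simp
  ultimately have "0 \<in> ?A" by blast
  then have "Max ?A \<in> ?A" using fin by (intro Max_in) auto
  then show ?ex unfolding F_turan_number_def by blast
  show "k \<le> F_turan_number F n G" if "F_packing F n k Fs" "\<not> (\<exists>G'. rainbow_copy G k Fs G')" for k Fs
    unfolding F_turan_number_def using fin that by (intro Max_ge) auto
qed

theorem theorem2:
  fixes F :: "'a graph" and G :: "'b graph"
  assumes "simple_graph F" and "simple_graph G"
    and "edges F \<noteq> {}" and "edges G \<noteq> {}"
    and "no_isolated_vertices F" and "no_isolated_vertices G"
    and "chromatic_number F < chromatic_number G"
  shows "(\<lambda>n. real (F_turan_number F n G))
           \<sim>[sequentially] (\<lambda>n. real (turan_number n G) / real (num_edges F)) \<and>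
         (\<lambda>n. real (turan_number n G) / real (num_edges F))
           \<sim>[sequentially]
         (\<lambda>n. (1 - 1 / (real (chromatic_number G) - 1)) / (2 * real (num_edges F)) * (real n)\<^sup>2)"
proof -
  note F = assms(1,3) and G = assms(2,4)
  \<comment> \<open>\<open>F\<close> is \<open>s\<close>-colourable by the hypothesis on the
    chromatic numbers, and \<open>2 \<le> s\<close> makes \<open>C\<close> positive.\<close>
  define s where "s = chromatic_number G - 1"
  have s: "2 \<le> s" "chromatic_number G = Suc s"
    using chromatic_number_ge_2[OF F] assms(7) unfolding s_def by auto
  define C where "C = (1 - 1 / real s) / 2"
  have C: "C > 0" using s(1) unfolding C_def by (simp add: field_simps)
  have eF: "num_edges F > 0" using F finite_edges[OF F(1)] unfolding num_edges_def by (simp add: card_gt_0_iff)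
  have "\<exists>c. proper_coloring F s c"
    using proper_coloring_chromatic_number[OF F(1)] proper_coloring_mono[of F "chromatic_number F" _ s] assms(7) s(2)
    by (metis less_Suc_eq_le)
  then obtain c where c: "proper_coloring F s c" by auto
  \<comment> \<open>One packing serves both numbers: its \<open>s\<close>-colourable union contains
    no \<open>G\<close>, hence no rainbow \<open>G\<close>, and it becomes a graph on exactly
    \<open>n\<close> vertices by adding isolated ones.\<close>
  have lower: "\<forall>\<^sub>F n in sequentially. (C - \<epsilon>) * (real n)\<^sup>2 \<le> real (turan_number n G) \<and>
      (C - \<epsilon>) * (real n)\<^sup>2 \<le> real (F_turan_number F n G * num_edges F)" if \<epsilon>: "\<epsilon> > 0" for \<epsilon> :: real
    using ex_dense_packing[OF F c s(1) \<epsilon>]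
  proof eventually_elim
    case (elim n)
    then obtain k Fs q where pack: "F_packing F n k Fs"
      and q: "\<And>v. v \<in> verts (graph_union k Fs) \<Longrightarrow> q v < s"
        "\<And>u v. {u, v} \<in> edges (graph_union k Fs) \<Longrightarrow> q u \<noteq> q v"
      and k: "(C - \<epsilon>) * (real n)\<^sup>2 \<le> real (k * num_edges F)"
      unfolding C_def by blast
    have lt: "s < chromatic_number G" using s by simp
    have "\<not> (subgraph G' (graph_union k Fs) \<and> isomorphic G' G)" for G'
      by (rule no_copy_of_larger_chromatic_number[where p = q, OF _ _ G(1) lt]) (use q in auto)
    then have "\<not> (\<exists>G'. rainbow_copy G k Fs G')" unfolding rainbow_copy_def by blast
    then have "k \<le> F_turan_number F n G" using F_turan_number_bounds(2)[OF F G pack] by blast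
    then have FT: "real (k * num_edges F) \<le> real (F_turan_number F n G * num_edges F)" by (intro of_nat_mono mult_right_mono) auto
    define H where "H = Graph {..<n} (edges (graph_union k Fs))"
    have "simple_graph H" "card (verts H) = n" "num_edges H = k * num_edges F"
      using card_edges_packing[OF F(1) pack] unfolding H_def simple_graph_def num_edges_def by auto
    moreover have "\<not> (subgraph G' H \<and> isomorphic G' G)" for G'
    proof (rule no_copy_of_larger_chromatic_number[OF _ _ G(1) lt])
      \<comment> \<open>The added vertices may take colour 0, since they lie on no edge.\<close>
      show "(if v \<in> verts (graph_union k Fs) then q v else 0) < s" for v using q(1) s(1) by auto
      show "(if u \<in> verts (graph_union k Fs) then q u else 0) \<noteq> (if v \<in> verts (graph_union k Fs) then q v else 0)"
        if e: "{u, v} \<in> edges H" for u v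
      proof -
        obtain i where i: "i < k" "{u, v} \<in> edges (Fs i)" using e unfolding H_def graph_union_def by auto
        then have "{u, v} \<subseteq> verts (Fs i)" using pack unfolding F_packing_def subgraph_def simple_graph_def by blast
        then have "u \<in> verts (graph_union k Fs)" "v \<in> verts (graph_union k Fs)"
          using i unfolding graph_union_def by auto
        then show ?thesis using q(2) e unfolding H_def by simp
      qed
    qed
    ultimately have "k * num_edges F \<le> turan_number n G" using turan_number_bounds(2)[OF G] by metis
    then have "real (k * num_edges F) \<le> real (turan_number n G)" by (rule of_nat_mono)
    with FT show ?case using k by linarith
  qed
  \<comment> \<open>One part size, large enough for ordinary and for rainbow embeddings.\<close>
  define T where "T = Suc (card (verts G) * (card (verts G) + num_edges G * card (verts F)))"
  have T: "card (verts G) * (card (verts G) + num_edges G * card (verts F)) < T"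
    "card (verts G) * card (verts G) < T" unfolding T_def by (auto simp: algebra_simps le_imp_less_Suc)
  \<comment> \<open>If a bound failed, Erdos-Stone would give large parts in the extremal graph, or
    in the union of an extremal packing, and hence a forbidden copy. The packing number is
    multiplied by \<open>num_edges F\<close> because the edges of the union are counted.\<close>
  have upper: "\<forall>\<^sub>F n in sequentially. real (turan_number n G) \<le> (C + \<epsilon>) * (real n)\<^sup>2 \<and>
      real (F_turan_number F n G * num_edges F) \<le> (C + \<epsilon>) * (real n)\<^sup>2" if \<epsilon>: "\<epsilon> > 0" for \<epsilon> :: real
  proof -
    have "1 \<le> s" using s(1) by simp
    from erdos_stone[OF this \<epsilon>] obtain n0 where n0: "\<forall>(V :: nat set) E. finite V \<longrightarrow> n0 \<le> card V \<longrightarrow>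
           (\<forall>e\<in>E. e \<subseteq> V \<and> card e = 2) \<longrightarrow>
           ((1 - 1 / real s) / 2 + \<epsilon>) * (card V)\<^sup>2 \<le> card E \<longrightarrow>
           has_partite V E (Suc s) T"
      by (rule exE)
    have "real (turan_number n G) \<le> (C + \<epsilon>) * (real n)\<^sup>2 \<and>
      real (F_turan_number F n G * num_edges F) \<le> (C + \<epsilon>) * (real n)\<^sup>2" if n: "n \<ge> n0" for n
    proof (intro conjI)
      show "real (turan_number n G) \<le> (C + \<epsilon>) * (real n)\<^sup>2"
      proof (rule ccontr)
        assume *: "\<not> ?thesis"
        obtain H :: "nat graph" where H: "turan_number n G = num_edges H" "simple_graph H" "card (verts H) = n"
            "\<not> (\<exists>G'. subgraph G' H \<and> isomorphic G' G)"
          using turan_number_bounds(1)[OF G] by blast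
        have "has_partite (verts H) (edges H) (Suc s) T"
          using H(2) n * unfolding simple_graph_def
          by (intro n0[rule_format]) (auto simp: H(1,3) C_def num_edges_def)
        then show False using ex_copy[OF G(1) _ T(2), of H] H(4) s(2) by metis
      qed
      show "real (F_turan_number F n G * num_edges F) \<le> (C + \<epsilon>) * (real n)\<^sup>2"
      proof (rule ccontr)
        assume *: "\<not> ?thesis"
        obtain Fs where Fs: "F_packing F n (F_turan_number F n G) Fs" "\<not> (\<exists>G'. rainbow_copy G (F_turan_number F n G) Fs G')"
          using F_turan_number_bounds(1)[OF F G] by blast
        have "has_partite {..<n} (edges (graph_union (F_turan_number F n G) Fs)) (Suc s) T"
          using n * card_edges_packing[OF F(1) Fs(1)]
          by (intro n0[rule_format]) (auto simp: C_def)
        then show False using ex_rainbow_copy[OF F(1) G(1) assms(6) Fs(1) _ T(1)] Fs(2) s(2) by metis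
      qed
    qed
    then show ?thesis unfolding eventually_sequentially by blast
  qed
  have "(\<lambda>n. real (turan_number n G)) \<sim>[sequentially] (\<lambda>n. C * (real n)\<^sup>2)"
    using C by (rule asymp_equiv_quadratic) (use upper lower in \<open>auto simp: eventually_conj_iff\<close>)
  then have 1: "(\<lambda>n. real (turan_number n G) / real (num_edges F)) \<sim>[sequentially] (\<lambda>n. C * (real n)\<^sup>2 / real (num_edges F))"
    by (intro asymp_equiv_intros)
  have "(\<lambda>n. real (F_turan_number F n G * num_edges F)) \<sim>[sequentially] (\<lambda>n. C * (real n)\<^sup>2)"
    using C by (rule asymp_equiv_quadratic) (use upper lower in \<open>auto simp: eventually_conj_iff\<close>)
  then have "(\<lambda>n. real (F_turan_number F n G * num_edges F) / real (num_edges F)) \<sim>[sequentially] (\<lambda>n. C * (real n)\<^sup>2 / real (num_edges F))"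
    by (intro asymp_equiv_intros)
  then have 2: "(\<lambda>n. real (F_turan_number F n G)) \<sim>[sequentially] (\<lambda>n. C * (real n)\<^sup>2 / real (num_edges F))"
    using eF by simp
  have "(\<lambda>n. C * (real n)\<^sup>2 / real (num_edges F)) =
      (\<lambda>n. (1 - 1 / (real (chromatic_number G) - 1)) / (2 * real (num_edges F)) * (real n)\<^sup>2)"
    unfolding C_def s(2) by (simp add: field_simps)
  with 1 2 show ?thesis using asymp_equiv_trans asymp_equiv_sym by metis
qed

end
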